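(* Let $\Lambda_N$ be a sequence of finite subsets of $\mathbb{Z}^d$ increasing to $\mathbb{Z}^d$, and take a subsequence of $N$'s along which the limit of $\phi_{\Lambda_N, N,\beta}(s):=\langle W_{l_1}\cdots W_{l_n}\rangle_{\Lambda_N,N,\beta}/N^n$ exists for every loop sequence $s=(l_1,\ldots,l_n)$. Call this limit $\phi_\beta(s)$. Take any non-null loop sequence $s$ with minimal representation $(l_1,\ldots, l_n)$. Let $e$ be the first edge of $l_1$, let $A_1$ (resp. $B_1$) be the set of locations in $l_1$ where $e$ (resp. $e^{-1}$) occurs, $C_1=A_1\cup B_1$ and $m=|C_1|$. Then \begin{align*} m \phi_\beta(s) &= \textup{splitting term} + \textup{deformation term}\, , \end{align*} where the splitting term is \begin{align*} &\sum_{x\in A_1, \, y\in B_1} \phi_\beta(\times_{x,y}^1 l_1, \times_{x,y}^2 l_1,l_2,\ldots,l_n)+\sum_{x\in B_1, \, y\in A_1} \phi_\beta(\times_{x,y}^1 l_1, \times_{x,y}^2 l_1,l_2,\ldots,l_n) \\ &\qquad- \sum_{\substack{x,y\in A_1\\ x\ne y}} \phi_\beta(\times^1_{x,y} l_1,\times^2_{x,y} l_1,l_2,\ldots,l_n) - \sum_{\substack{x,y\in B_1\\ x\ne y}} \phi_\beta(\times^1_{x,y} l_1,\times^2_{x,y} l_1,l_2,\ldots,l_n)\, , \end{align*} and the deformation term is \begin{align*} &\beta \sum_{p\in \mathcal{P}^+(e)}\sum_{x\in C_1}\phi_\beta(l_1 \ominus_{x}p,l_2,\ldots,l_n) - \beta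 \sum_{p\in \mathcal{P}^+(e)}\sum_{x\in C_1}\phi_\beta(l_1 \oplus_{x}p,l_2,\ldots,l_n) \, . \end{align*}
   Context: Setting: the lattice $\mathbb{Z}^d$, $d\ge 2$, with directed nearest-neighbour edges; $e^{-1}$ is the reversed edge. Closed paths modulo cyclic rotation are cycles (with a "first edge" fixed by an arbitrary rule; locations counted from it); a backtrack is a consecutive pair $e\,e^{-1}$ (cyclically); $[l]$ is the nonbacktracking core obtained by repeatedly erasing backtracks. A loop is a nonbacktracking cycle; a plaquette is a nonbacktracking closed path of length 4; $\mathcal{P}^+(e)$ is the set of positively oriented plaquettes containing $e$ or $e^{-1}$. A loop sequence is a finite sequence of loops modulo insertion/deletion of null loops; the minimal representation has no null loops. Splitting of a loop $l$ at distinct locations $x,y$: if the same edge $e$ is at $x$ and $y$, write $l=aebec$ and set $\times^1_{x,y}l=[aec]$, $\times^2_{x,y}l=[be]$; if $e$ is at $x$ and $e^{-1}$ at $y$, write $l=aebe^{-1}c$ and set $\times^1_{x,y}l=[ac]$, $\times^2_{x,y}l=[b]$. Deformation: for a plaquette $p$ containing the edge at location $x$ of $l$ or its inverse, with $p$ having that edge $e$ (or $e^{-1}$) at its unique location: if $p$ carries $e$, writing $l=aeb$, $p=ced$, $l\oplus_x p=[aedceb]$ and $l\ominus_x p=[ac^{-1}d^{-1}b]$; if $p$ carries $e^{-1}$, writing $p=ce^{-1}d$, $l\oplus_x p=[aec^{-1}d^{-1}eb]$ and $l\ominus_x p=[adcb]$. $SO(N)$ lattice gauge theory on finite $\Lambda$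 at inverse coupling $\beta\in\mathbb{R}$: the probability measure proportional to $\exp(N\beta\sum_{p\in\mathcal{P}^+_\Lambda}\operatorname{Tr}(Q_p))\prod_{e\in E^+_\Lambda}d\sigma_N(Q_e)$ with Haar measure $\sigma_N$ on $SO(N)$, $Q_{e^{-1}}=Q_e^{-1}$; $\langle\cdot\rangle_{\Lambda,N,\beta}$ is its expectation; $W_l=\operatorname{Tr}(Q_{e_1}\cdots Q_{e_n})$ for $l=e_1\cdots e_n$ and $W_\emptyset=N$. Since $|W_l|\le N$, a subsequence as in the claim always exists by a diagonal argument. *)

theory Defs
  imports "HOL-Probability.Probability"
begin

type_synonym vertex = "int list"
type_synonym edge = "vertex \<times> vertex"

definition vtx :: "nat \<Rightarrow> vertex set" where
  "vtx d = {x. length x = d}"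

definition step :: "vertex \<Rightarrow> nat \<Rightarrow> vertex" where
  "step x i = x[i := x ! i + 1]"

definition einv :: "edge \<Rightarrow> edge" where
  "einv e = (snd e, fst e)"

definition pos_edge :: "nat \<Rightarrow> edge \<Rightarrow> bool" where
  "pos_edge d e \<longleftrightarrow> fst e \<in> vtx d \<and> (\<exists>i<d. snd e = step (fst e) i)"

definition is_edge :: "nat \<Rightarrow> edge \<Rightarrow> bool" where
  "is_edge d e \<longleftrightarrow> pos_edge d e \<or> pos_edge d (einv e)"

definition pinv :: "edge list \<Rightarrow> edge list" where
  "pinv q = rev (map einv q)"

text \<open>Closed paths (nonempty); a cycle is represented by any of its rotations.\<close>
definition closed_path :: "nat \<Rightarrow> edge list \<Rightarrow> bool" where
  "closed_path d l \<longleftrightarrow> l \<noteq> [] \<and> (\<forall>e\<in>set l. is_edge d e)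
     \<and> (\<forall>k. Suc k < length l \<longrightarrow> snd (l ! k) = fst (l ! Suc k))
     \<and> snd (last l) = fst (hd l)"

definition nonbacktracking :: "edge list \<Rightarrow> bool" where
  "nonbacktracking l \<longleftrightarrow>
     (\<forall>k<length l. l ! (Suc k mod length l) \<noteq> einv (l ! k))"

definition is_loop :: "nat \<Rightarrow> edge list \<Rightarrow> bool" where
  "is_loop d l \<longleftrightarrow> closed_path d l \<and> nonbacktracking l"

text \<open>Loop sequences: lists of loops, where the empty list is the null loop.\<close>
definition loop_seq :: "nat \<Rightarrow> edge list list \<Rightarrow> bool" where
  "loop_seq d s \<longleftrightarrow> (\<forall>l\<in>set s. l = [] \<or> is_loop d l)"

text \<open>Nonbacktracking core: linear free reduction followed by cyclic reduction
  (yields a representative of the core cycle; [] is the null loop).\<close>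
definition freered :: "edge list \<Rightarrow> edge list" where
  "freered l = foldr (\<lambda>e acc. case acc of [] \<Rightarrow> [e]
        | f # r \<Rightarrow> (if f = einv e then r else e # acc)) l []"

function cycred :: "edge list \<Rightarrow> edge list" where
  "cycred l = (if 2 \<le> length l \<and> hd l = einv (last l)
               then cycred (butlast (tl l)) else l)"
  by pat_completeness auto
termination by (relation "Wellfounded.measure length") auto

definition core :: "edge list \<Rightarrow> edge list" where
  "core l = cycred (freered l)"

definition cseg :: "edge list \<Rightarrow> nat \<Rightarrow> nat \<Rightarrow> edge list" where
  "cseg l i j = map (\<lambda>k. l ! ((i + 1 + k) mod length l))
                   [0..<(j + length l - i - 1) mod length l]"

definition split1 :: "edge list \<Rightarrow> nat \<Rightarrow> nat \<Rightarrow> edge list" where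
  "split1 l x y = (if l ! y = l ! x then core (l ! x # cseg l y x)
                   else core (cseg l y x))"

definition split2 :: "edge list \<Rightarrow> nat \<Rightarrow> nat \<Rightarrow> edge list" where
  "split2 l x y = (if l ! y = l ! x then core (cseg l x y @ [l ! x])
                   else core (cseg l x y))"

definition pidx :: "edge list \<Rightarrow> edge \<Rightarrow> nat" where
  "pidx p f = (LEAST k. k < length p \<and> p ! k = f)"

text \<open>Deformations. With f the edge at location x, l is the cycle f # rest.\<close>
definition dplus :: "edge list \<Rightarrow> nat \<Rightarrow> edge list \<Rightarrow> edge list" where
  "dplus l x p = (let f = l ! x; rest = cseg l x x in
     if f \<in> set p then
       (let k = pidx p f; c = take k p; d = drop (Suc k) p in
          core (f # d @ c @ f # rest))
     else
       (let k = pidx p (einv f); c = take k p; d = drop (Suc k) p in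
          core (f # pinv c @ pinv d @ f # rest)))"

definition dminus :: "edge list \<Rightarrow> nat \<Rightarrow> edge list \<Rightarrow> edge list" where
  "dminus l x p = (let f = l ! x; rest = cseg l x x in
     if f \<in> set p then
       (let k = pidx p f; c = take k p; d = drop (Suc k) p in
          core (pinv c @ pinv d @ rest))
     else
       (let k = pidx p (einv f); c = take k p; d = drop (Suc k) p in
          core (d @ c @ rest)))"

definition plaq :: "vertex \<Rightarrow> nat \<Rightarrow> nat \<Rightarrow> edge list" where
  "plaq x i j = [(x, step x i), (step x i, step (step x i) j),
                 (step (step x i) j, step x j), (step x j, x)]"

definition Pplus :: "nat \<Rightarrow> edge list set" where
  "Pplus d = {plaq x i j | x i j. x \<in> vtx d \<and> i < j \<and> j < d}"

definition Pplus_e :: "nat \<Rightarrow> edge \<Rightarrow> edge list set" where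
  "Pplus_e d e = {p \<in> Pplus d. e \<in> set p \<or> einv e \<in> set p}"

definition Pplus_L :: "nat \<Rightarrow> vertex set \<Rightarrow> edge list set" where
  "Pplus_L d L = {p \<in> Pplus d. \<forall>f\<in>set p. fst f \<in> L}"

definition Epos_L :: "nat \<Rightarrow> vertex set \<Rightarrow> edge set" where
  "Epos_L d L = {e. pos_edge d e \<and> fst e \<in> L \<and> snd e \<in> L}"

text \<open>N x N real matrices as functions nat => nat => real, zero outside {..<N}^2
  (product topology, hence Borel sigma algebra = product sigma algebra).\<close>
type_synonym mat = "nat \<Rightarrow> nat \<Rightarrow> real"

definition mmul :: "nat \<Rightarrow> mat \<Rightarrow> mat \<Rightarrow> mat" where
  "mmul N A B = (\<lambda>i j. if i < N \<and> j < N then \<Sum>k<N. A i k * B k j else 0)"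

definition mid :: "nat \<Rightarrow> mat" where
  "mid N = (\<lambda>i j. if i < N \<and> j < N \<and> i = j then 1 else 0)"

definition mtrans :: "mat \<Rightarrow> mat" where
  "mtrans A = (\<lambda>i j. A j i)"

definition mtrace :: "nat \<Rightarrow> mat \<Rightarrow> real" where
  "mtrace N A = (\<Sum>i<N. A i i)"

definition mdet :: "nat \<Rightarrow> mat \<Rightarrow> real" where
  "mdet N A = (\<Sum>p | p permutes {..<N}. of_int (sign p) * (\<Prod>i<N. A i (p i)))"

definition SO :: "nat \<Rightarrow> mat set" where
  "SO N = {A. (\<forall>i j. (N \<le> i \<or> N \<le> j) \<longrightarrow> A i j = 0)
              \<and> mmul N A (mtrans A) = mid N \<and> mdet N A = 1}"

text \<open>Haar probability measure on SO(N): a left-invariant Borel probability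
  measure concentrated on SO(N) (unique by uniqueness of Haar measure).\<close>
definition haar_SO :: "nat \<Rightarrow> mat measure \<Rightarrow> bool" where
  "haar_SO N \<mu> \<longleftrightarrow> prob_space \<mu> \<and> sets \<mu> = sets borel \<and> emeasure \<mu> (SO N) = 1
     \<and> (\<forall>g\<in>SO N. distr \<mu> borel (\<lambda>A. mmul N g A) = \<mu>)"

text \<open>Configuration: Q e for positive edges; Q_{e^-1} = Q_e^{-1} = Q_e^T on SO(N).\<close>
definition Qof :: "nat \<Rightarrow> (edge \<Rightarrow> mat) \<Rightarrow> edge \<Rightarrow> mat" where
  "Qof d Q e = (if pos_edge d e then Q e else mtrans (Q (einv e)))"

definition hol :: "nat \<Rightarrow> nat \<Rightarrow> (edge \<Rightarrow> mat) \<Rightarrow> edge list \<Rightarrow> mat" where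
  "hol d N Q l = foldr (\<lambda>e M. mmul N (Qof d Q e) M) l (mid N)"

definition W :: "nat \<Rightarrow> nat \<Rightarrow> (edge \<Rightarrow> mat) \<Rightarrow> edge list \<Rightarrow> real" where
  "W d N Q l = mtrace N (hol d N Q l)"

definition gauge_weight :: "nat \<Rightarrow> vertex set \<Rightarrow> nat \<Rightarrow> real \<Rightarrow> (edge \<Rightarrow> mat) \<Rightarrow> real" where
  "gauge_weight d L N \<beta> Q = exp (real N * \<beta> * (\<Sum>p\<in>Pplus_L d L. W d N Q p))"

definition lgt_expect :: "nat \<Rightarrow> vertex set \<Rightarrow> nat \<Rightarrow> real \<Rightarrow> mat measure
     \<Rightarrow> ((edge \<Rightarrow> mat) \<Rightarrow> real) \<Rightarrow> real" where
  "lgt_expect d L N \<beta> \<sigma> F =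
     (\<integral>Q. F Q * gauge_weight d L N \<beta> Q \<partial>(PiM (Epos_L d L) (\<lambda>_. \<sigma>)))
     / (\<integral>Q. gauge_weight d L N \<beta> Q \<partial>(PiM (Epos_L d L) (\<lambda>_. \<sigma>)))"

definition phi_fin :: "nat \<Rightarrow> vertex set \<Rightarrow> nat \<Rightarrow> real \<Rightarrow> mat measure
     \<Rightarrow> edge list list \<Rightarrow> real" where
  "phi_fin d L N \<beta> \<sigma> s =
     lgt_expect d L N \<beta> \<sigma> (\<lambda>Q. \<Prod>i<length s. W d N Q (s ! i)) / real N ^ length s"

end

theory Submission
  imports Defs
begin

text \<open>Left multiplication of one edge variable by the rotation through the angle \<open>t\<close> in the \<open>(a, b)\<close>
  coordinate plane preserves Haar measure, so differentiating at \<open>t = 0\<close> shows that the derivative of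
  any bounded smooth observable times the Boltzmann weight integrates to zero. Apply this to the matrix
  entry \<open>(b, a)\<close> of the holonomy of \<open>l\<^sub>1\<close>, cut open at one occurrence of \<open>e\<close> or its inverse,
  times the other Wilson loops, and sum over all \<open>a, b\<close>. With \<open>X = E\<^sub>a\<^sub>b - E\<^sub>b\<^sub>a\<close>, inserting \<open>X\<close> between
  \<open>P\<close> and \<open>S\<close> contracts to \<open>tr (P\<^sup>T S) - tr P tr S\<close>: the second term is a splitting, the first
  is of lower order in \<open>N\<close>, except that cutting at the same place twice gives \<open>- (N - 1) W\<close>. The
  derivative of the weight yields the two deformations of each plaquette, weighted by \<open>N \<beta>\<close>, and the
  derivatives of the other loops are again of lower order. Dividing by the power of \<open>N\<close> and passing to
  the limit gives the equation for each cut location separately.\<close>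

subsection \<open>Matrices\<close>

text \<open>With \<open>e\<close> in front, the open holonomy \<open>H\<close> contains the chosen
  occurrence as its first letter, and H_ba - H_ab = tr(XH) is the derivative of the Wilson loop when
  this one occurrence alone is rotated. So the identity is an integrated Laplacian that treats one
  occurrence at a time, which is why it holds location by location and why the factor
  \<open>m\<close> appears only on summing. Differentiation under the integral rests on compactness:
  entries of orthogonal matrices are bounded by 1. The measure lives on all matrices, however, so
  derivative formulas are proved for every configuration and bounds only on an almost sure event.
  Reduction to nonbacktracking cores is invisible to Wilson loops, because adjacent inverse pairs
  cancel. All errors are therefore counted in numbers of traces: each missing trace costs a factor
  \<open>N\<close>, and the final error is a constant depending only on the lengths of the loops,
  divided by \<open>N\<close>.\<close>

definition msupp :: "nat \<Rightarrow> mat \<Rightarrow> bool" where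
  "msupp N A \<longleftrightarrow> (\<forall>i j. N \<le> i \<or> N \<le> j \<longrightarrow> A i j = 0)"

text \<open>Recording both products makes the predicate symmetric under transposition, which is what
  reversing an edge does to its matrix.\<close>

definition orth :: "nat \<Rightarrow> mat \<Rightarrow> bool" where
  "orth N A \<longleftrightarrow> msupp N A \<and> mmul N A (mtrans A) = mid N \<and> mmul N (mtrans A) A = mid N"

lemma msupp_mmul [simp]: "msupp N (mmul N A B)"
  and msupp_mid [simp]: "msupp N (mid N)"
  by (auto simp: msupp_def mmul_def mid_def)

lemma msupp_mtrans [simp]: "msupp N (mtrans A) \<longleftrightarrow> msupp N A"
  by (auto simp: msupp_def mtrans_def)

lemma mtrans_mtrans [simp]: "mtrans (mtrans A) = A"
  by (simp add: mtrans_def)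

lemma mtrans_mid [simp]: "mtrans (mid N) = mid N"
  by (auto simp: mtrans_def mid_def fun_eq_iff)

lemma mtrans_mmul: "mtrans (mmul N A B) = mmul N (mtrans B) (mtrans A)"
  by (auto simp: mtrans_def mmul_def fun_eq_iff mult.commute)

lemma mmul_assoc: "mmul N (mmul N A B) C = mmul N A (mmul N B C)"
proof (intro ext)
  fix i j
  have "(\<Sum>k<N. (\<Sum>m<N. A i m * B m k) * C k j) = (\<Sum>k<N. A i k * (\<Sum>m<N. B k m * C m j))"
    by (subst sum_distrib_right, subst sum.swap) (simp add: sum_distrib_left mult.assoc)
  then show "mmul N (mmul N A B) C i j = mmul N A (mmul N B C) i j"
    by (auto simp: mmul_def)
qed

text \<open>Products are cut off outside the \<open>N\<close> by \<open>N\<close> block, so the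
  identity matrix can reproduce only a matrix that vanishes there. This is the source of the support
  conditions in what follows.\<close>

lemma mmul_mid_left: assumes "msupp N A" shows "mmul N (mid N) A = A"
proof (intro ext)
  fix i j
  have "(\<Sum>k<N. mid N i k * A k j) = A i j" if "i < N"
    using that by (simp add: mid_def if_distrib[of "\<lambda>x. x * _"] sum.delta cong: if_cong)
  then show "mmul N (mid N) A i j = A i j"
    using assms by (auto simp: mmul_def msupp_def)
qed

lemma mmul_mid_right: assumes "msupp N A" shows "mmul N A (mid N) = A"
  using arg_cong[OF mmul_mid_left[of N "mtrans A"], of mtrans] assms by (simp add: mtrans_mmul)

lemma mtrace_mtrans [simp]: "mtrace N (mtrans A) = mtrace N A"
  by (simp add: mtrace_def mtrans_def)

lemma mtrace_mmul: "mtrace N (mmul N A B) = (\<Sum>i<N. \<Sum>j<N. A i j * B j i)"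
  by (simp add: mtrace_def mmul_def)

lemma mtrace_mmul_commute: "mtrace N (mmul N A B) = mtrace N (mmul N B A)"
  unfolding mtrace_mmul by (subst sum.swap) (simp add: mult.commute)

lemma mtrace_mid [simp]: "mtrace N (mid N) = real N"
  by (simp add: mtrace_def mid_def)

lemma mtrace_mtrans_mmul: "mtrace N (mmul N (mtrans A) B) = (\<Sum>i<N. \<Sum>j<N. A i j * B i j)"
  unfolding mtrace_mmul mtrans_def by (subst sum.swap) simp

text \<open>With \<open>P\<close> the transpose of \<open>A\<close> times \<open>A\<close>, the squared Frobenius norm of \<open>1 - P\<close> is
  \<open>N - 2 tr P + tr P\<^sup>2 = 0\<close>.\<close>
lemma orthI:
  assumes s: "msupp N A" and AA: "mmul N A (mtrans A) = mid N"
  shows "orth N A"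
proof -
  define P where "P = mmul N (mtrans A) A"
  have Pt: "mtrans P = P" by (simp add: P_def mtrans_mmul)
  have "mmul N P P = mmul N (mtrans A) (mmul N (mmul N A (mtrans A)) A)"
    by (simp add: P_def mmul_assoc)
  also have "\<dots> = P" by (simp add: AA mmul_mid_left s P_def)
  finally have PP: "mmul N P P = P" .
  have trP: "mtrace N P = real N"
    unfolding P_def by (subst mtrace_mmul_commute) (simp add: AA)
  have "(\<Sum>i<N. \<Sum>j<N. P i j * P i j) = real N"
    using mtrace_mtrans_mmul[of N P P] by (simp add: Pt PP trP)
  moreover have "(\<Sum>i<N. \<Sum>j<N. 2 * (mid N i j * P i j)) = 2 * real N"
    using mtrace_mtrans_mmul[of N "mid N" P] mmul_mid_left[of N P] trP
    by (simp add: P_def flip: sum_distrib_left)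
  moreover have "(\<Sum>i<N. \<Sum>j<N. mid N i j * mid N i j) = real N"
    using mtrace_mtrans_mmul[of N "mid N" "mid N"] mmul_mid_left[of N "mid N"] by simp
  ultimately have "(\<Sum>i<N. \<Sum>j<N. (mid N i j - P i j)\<^sup>2) = 0"
    by (simp add: power2_diff sum.distrib sum_subtractf mult.assoc) (simp add: power2_eq_square)
  then have z: "mid N i j = P i j" if "i < N" "j < N" for i j
    using that by (auto simp: sum_nonneg_eq_0_iff sum_nonneg)
  have "P = mid N"
  proof (intro ext)
    fix i j show "P i j = mid N i j"
    proof (cases "i < N \<and> j < N")
      case False
      then show ?thesis by (auto simp: P_def mmul_def mid_def)
    qed (simp add: z)
  qed
  then show ?thesis using s AA by (simp add: orth_def P_def)
qed

lemma orth_SO: "A \<in> SO N \<Longrightarrow> orth N A"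
  by (rule orthI) (auto simp: SO_def msupp_def)

lemma orth_mid [simp]: "orth N (mid N)"
  by (simp add: orth_def mmul_mid_left)

lemma orth_mtrans: "orth N A \<Longrightarrow> orth N (mtrans A)"
  by (simp add: orth_def)

lemma orth_mmul: assumes "orth N A" "orth N B" shows "orth N (mmul N A B)"
proof (rule orthI)
  have "mmul N (mmul N A B) (mtrans (mmul N A B))
      = mmul N A (mmul N (mmul N B (mtrans B)) (mtrans A))"
    by (simp add: mtrans_mmul mmul_assoc)
  then show "mmul N (mmul N A B) (mtrans (mmul N A B)) = mid N"
    using assms by (simp add: orth_def mmul_mid_left)
qed simp

lemma orth_entry_le: assumes "orth N A" shows "\<bar>A i j\<bar> \<le> 1"
proof (cases "i < N \<and> j < N")
  case True
  have "(\<Sum>k<N. (A i k)\<^sup>2) = mmul N A (mtrans A) i i"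
    using True by (simp add: mmul_def mtrans_def power2_eq_square)
  also have "\<dots> = 1" using assms True by (simp add: orth_def mid_def)
  finally have "(A i j)\<^sup>2 \<le> 1"
    using member_le_sum[of j "{..<N}" "\<lambda>k. (A i k)\<^sup>2"] True by simp
  then show ?thesis by (simp add: abs_square_le_1)
next
  case False
  then show ?thesis using assms by (auto simp: orth_def msupp_def)
qed

lemma orth_mtrace_le: assumes "orth N A" shows "\<bar>mtrace N A\<bar> \<le> real N"
proof -
  have "\<bar>mtrace N A\<bar> \<le> (\<Sum>i<N. \<bar>A i i\<bar>)" unfolding mtrace_def by (rule sum_abs)
  also have "\<dots> \<le> (\<Sum>i<N. 1)" by (intro sum_mono orth_entry_le[OF assms])
  finally show ?thesis by simp
qed

text \<open>The one-parameter group exp(tX) of SO(N) for distinct \<open>a\<close>,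
  \<open>b\<close>, with X = E_ab - E_ba.\<close>

definition rot :: "nat \<Rightarrow> nat \<Rightarrow> nat \<Rightarrow> real \<Rightarrow> mat" where
  "rot N a b t = (\<lambda>i j. if i < N \<and> j < N then
      (if i = j then (if i = a \<or> i = b then cos t else 1)
       else if i = a \<and> j = b then sin t else if i = b \<and> j = a then - sin t else 0) else 0)"

lemma mmul_rot:
  assumes "a < N" "b < N" "a \<noteq> b" and i: "i < N" "j < N"
  shows "mmul N (rot N a b t) A i j =
    (if i = a then cos t * A a j + sin t * A b j
     else if i = b then cos t * A b j - sin t * A a j else A i j)"
proof -
  have "(\<Sum>k<N. rot N a b t i k * A k j)
      = (\<Sum>k<N. (if k = i then rot N a b t i i * A i j else 0)
         + (if k = a then (if i = b then - sin t * A a j else 0) else 0)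
         + (if k = b then (if i = a then sin t * A b j else 0) else 0))"
    using assms by (intro sum.cong) (auto simp: rot_def)
  also have "\<dots> = rot N a b t i i * A i j + (if i = b then - sin t * A a j else 0)
       + (if i = a then sin t * A b j else 0)"
    using assms by (simp add: sum.distrib)
  finally have "mmul N (rot N a b t) A i j = rot N a b t i i * A i j
       + (if i = b then - sin t * A a j else 0) + (if i = a then sin t * A b j else 0)"
    using i by (simp add: mmul_def)
  then show ?thesis
    using assms by (simp add: rot_def)
qed

text \<open>Outside the rows \<open>a\<close> and \<open>b\<close> the matrix agrees with the
  identity, so in the Leibniz sum only permutations fixing all other indices contribute: the
  identity with cos^2 and the transposition with sin^2.\<close>

lemma mdet_rot:
  assumes "a < N" "b < N" "a \<noteq> b"
  shows "mdet N (rot N a b t) = 1"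
proof -
  let ?R = "rot N a b t" and ?\<tau> = "Transposition.transpose a b"
  let ?f = "\<lambda>p. of_int (sign p) * (\<Prod>i<N. ?R i (p i))"
  have \<tau>: "?\<tau> permutes {..<N}" using assms by (intro permutes_swap_id) auto
  have "?f p = 0" if p: "p permutes {..<N}" and n: "p \<notin> {id, ?\<tau>}" for p
  proof -
    have "\<not> p permutes {a, b}" using n by (simp add: permutes_doubleton_iff)
    moreover have "p permutes {a, b}" if "\<And>i. i \<notin> {a, b} \<Longrightarrow> p i = i"
      using that by (intro permutes_superset[OF p]) auto
    ultimately obtain i where i: "i \<notin> {a, b}" "p i \<noteq> i" by blast
    then have "i < N" using p by (metis lessThan_iff permutes_not_in)
    moreover have "?R i (p i) = 0" using i by (auto simp: rot_def)
    ultimately have "(\<Prod>i<N. ?R i (p i)) = 0" by (intro prod_zero) auto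
    then show ?thesis by simp
  qed
  then have "mdet N ?R = (\<Sum>p\<in>{id, ?\<tau>}. ?f p)"
    unfolding mdet_def using \<tau> permutes_id by (intro sum.mono_neutral_right finite_permutations) auto
  also have "\<dots> = ?f id + ?f ?\<tau>"
  proof -
    have "id \<noteq> ?\<tau>" using assms by (metis id_apply transpose_apply_first)
    then show ?thesis by simp
  qed
  also have "(\<Prod>i<N. ?R i (id i)) = (\<Prod>i\<in>{a,b}. cos t)"
    using assms by (intro prod.mono_neutral_cong_right) (auto simp: rot_def)
  also have "(\<Prod>i<N. ?R i (?\<tau> i)) = (\<Prod>i\<in>{a,b}. if i = a then sin t else - sin t)"
    using assms by (intro prod.mono_neutral_cong_right) (auto simp: rot_def transpose_def)
  also have "sign ?\<tau> = -1" using assms by (simp add: sign_swap_id)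
  finally have "mdet N ?R = (cos t)\<^sup>2 + (sin t)\<^sup>2"
    using assms by (simp add: power2_eq_square)
  then show ?thesis by simp
qed

lemma rot_SO:
  assumes "a < N" "b < N" "a \<noteq> b"
  shows "rot N a b t \<in> SO N"
proof -
  have *: "cos t * cos t + sin t * sin t = 1" "sin t * sin t + cos t * cos t = 1"
    using sin_cos_squared_add[of t] by (simp_all add: power2_eq_square)
  have "mmul N (rot N a b t) (mtrans (rot N a b t)) i j = mid N i j" for i j
  proof (cases "i < N \<and> j < N")
    case True
    then show ?thesis using assms * by (auto simp: mmul_rot) (auto simp: mtrans_def rot_def mid_def *)
  next
    case False
    then show ?thesis by (auto simp: mmul_def mid_def)
  qed
  then have "mmul N (rot N a b t) (mtrans (rot N a b t)) = mid N"
    by (intro ext)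
  moreover have "rot N a b t i j = 0" if "N \<le> i \<or> N \<le> j" for i j
  proof -
    have "\<not> (i < N \<and> j < N)" using that by linarith
    then show ?thesis unfolding rot_def by (rule if_not_P)
  qed
  ultimately show ?thesis
    unfolding SO_def by (intro CollectI conjI allI impI mdet_rot[OF assms])
qed

lemma rot_0: "rot N a b 0 = mid N"
proof (intro ext)
  fix i j
  show "rot N a b 0 i j = mid N i j"
    unfolding rot_def mid_def cos_zero sin_zero minus_zero if_cancel
    by (cases "i < N"; cases "j < N"; cases "i = j"; simp only: if_cancel if_True if_False simp_thms)
qed

text \<open>The derivative is X times the rotated matrix, for every \<open>t\<close> and not only at
  0: the mean value theorem will need it at intermediate angles.\<close>

lemma has_derivative_mmul_rot:
  assumes "a < N" "b < N" "a \<noteq> b" and i: "i < N" "j < N"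
  shows "((\<lambda>t. mmul N (rot N a b t) A i j) has_real_derivative
     (mid N i a * mmul N (rot N a b t) A b j - mid N i b * mmul N (rot N a b t) A a j)) (at t)"
proof -
  have *: "(\<lambda>t. mmul N (rot N a b t) A i j) =
     (if i = a then (\<lambda>t. cos t * A a j + sin t * A b j)
     else if i = b then (\<lambda>t. cos t * A b j - sin t * A a j) else (\<lambda>t. A i j))"
    using assms by (auto simp: mmul_rot fun_eq_iff)
  consider "i = a" | "i = b" | "i \<noteq> a" "i \<noteq> b" by blast
  then show ?thesis
    unfolding * using assms
    by cases (auto simp: mmul_rot mid_def intro!: derivative_eq_intros)
qed

subsection \<open>Edges and holonomies\<close>

lemma einv_einv [simp]: "einv (einv e) = e"
  by (simp add: einv_def)

lemma einv_inj [simp]: "einv e = einv f \<longleftrightarrow> e = f"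
  by (metis einv_einv)

lemma fst_einv [simp]: "fst (einv e) = snd e" and snd_einv [simp]: "snd (einv e) = fst e"
  by (simp_all add: einv_def)

lemma is_edge_einv [simp]: "is_edge d (einv e) \<longleftrightarrow> is_edge d e"
  by (auto simp: is_edge_def)

lemma sum_list_step: "i < length x \<Longrightarrow> sum_list (step x i) = sum_list x + 1"
  unfolding step_def by (induction x arbitrary: i) (auto split: nat.splits)

text \<open>The coordinate sum is a height function raised by one along each positive edge. It shows
  that only one of the two orientations is positive and that no edge is its own inverse.\<close>

lemma pos_edge_sum: "pos_edge d e \<Longrightarrow> sum_list (snd e) = sum_list (fst e) + 1"
  by (auto simp: pos_edge_def vtx_def sum_list_step)

lemma not_pos_edge_einv: "pos_edge d e \<Longrightarrow> \<not> pos_edge d (einv e)"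
  using pos_edge_sum[of d e] pos_edge_sum[of d "einv e"] by auto

lemma is_edge_fst_neq_snd: "is_edge d e \<Longrightarrow> fst e \<noteq> snd e"
  unfolding is_edge_def using pos_edge_sum[of d e] pos_edge_sum[of d "einv e"] by auto

lemma einv_neq: "is_edge d e \<Longrightarrow> einv e \<noteq> e"
  using is_edge_fst_neq_snd by (metis fst_einv)

lemma Qof_einv: "is_edge d e \<Longrightarrow> Qof d Q (einv e) = mtrans (Qof d Q e)"
  by (auto simp: Qof_def is_edge_def dest: not_pos_edge_einv)

lemma pinv_Nil [simp]: "pinv [] = []"
  and pinv_Cons: "pinv (e # l) = pinv l @ [einv e]"
  and pinv_append [simp]: "pinv (u @ v) = pinv v @ pinv u"
  and set_pinv [simp]: "set (pinv l) = einv ` set l"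
  by (simp_all add: pinv_def rev_map comp_def)

lemma hol_Nil [simp]: "hol d N Q [] = mid N"
  and hol_Cons [simp]: "hol d N Q (e # l) = mmul N (Qof d Q e) (hol d N Q l)"
  by (simp_all add: hol_def)

lemma msupp_hol [simp]: "msupp N (hol d N Q l)"
  by (cases l) simp_all

lemma hol_append: "hol d N Q (u @ v) = mmul N (hol d N Q u) (hol d N Q v)"
  by (induction u) (simp_all add: mmul_mid_left mmul_assoc)

lemma W_commute: "W d N Q (u @ v) = W d N Q (v @ u)"
  unfolding W_def hol_append by (rule mtrace_mmul_commute)

lemma W_Nil [simp]: "W d N Q [] = real N"
  by (simp add: W_def)

lemma W_rotate [simp]: "W d N Q (rotate k l) = W d N Q l"
proof (induction k)
  case (Suc k)
  have "W d N Q (rotate1 m) = W d N Q m" for m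
    using W_commute[of d N Q "[hd m]" "tl m"] by (cases m) simp_all
  with Suc show ?case by simp
qed simp

text \<open>A pointwise condition on the letters of one word, so that the algebra of holonomies can
  be done without reference to the measure or the finite region.\<close>

definition orth_on :: "nat \<Rightarrow> nat \<Rightarrow> (edge \<Rightarrow> mat) \<Rightarrow> edge list \<Rightarrow> bool" where
  "orth_on d N Q l \<longleftrightarrow> (\<forall>f\<in>set l. is_edge d f \<and> orth N (Qof d Q f))"

lemma orth_on_simps [simp]:
  "orth_on d N Q []"
  "orth_on d N Q (f # l) \<longleftrightarrow> is_edge d f \<and> orth N (Qof d Q f) \<and> orth_on d N Q l"
  "orth_on d N Q (u @ v) \<longleftrightarrow> orth_on d N Q u \<and> orth_on d N Q v"
  by (auto simp: orth_on_def)

lemma orth_on_subset: "orth_on d N Q l \<Longrightarrow> set k \<subseteq> set l \<Longrightarrow> orth_on d N Q k"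
  by (auto simp: orth_on_def)

lemma orth_on_pinv: "orth_on d N Q l \<Longrightarrow> orth_on d N Q (pinv l)"
  by (auto simp: orth_on_def Qof_einv orth_mtrans)

lemma orth_hol: "orth_on d N Q l \<Longrightarrow> orth N (hol d N Q l)"
  by (induction l) (auto intro: orth_mmul)

lemma W_le: "orth_on d N Q l \<Longrightarrow> \<bar>W d N Q l\<bar> \<le> real N"
  unfolding W_def by (intro orth_mtrace_le orth_hol)

lemma hol_pinv: "\<forall>f\<in>set l. is_edge d f \<Longrightarrow> hol d N Q (pinv l) = mtrans (hol d N Q l)"
proof (induction l)
  case (Cons f l)
  have "mmul N A (mmul N B (mid N)) = mmul N A B" for A B
    by (simp add: mmul_mid_right flip: mmul_assoc)
  then show ?case using Cons by (simp add: pinv_Cons hol_append Qof_einv mtrans_mmul)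
qed simp

lemma hol_einv_cancel:
  "is_edge d f \<Longrightarrow> orth N (Qof d Q f) \<Longrightarrow> hol d N Q (f # einv f # l) = hol d N Q l"
  "is_edge d f \<Longrightarrow> orth N (Qof d Q f) \<Longrightarrow> hol d N Q (einv f # f # l) = hol d N Q l"
  by (simp_all add: Qof_einv orth_def mmul_mid_left flip: mmul_assoc)

subsection \<open>Rotating the matrix of one edge\<close>

text \<open>Replacing \<open>Q e\<close> by \<open>R * Q e\<close> puts \<open>R\<close> before an occurrence of \<open>e\<close>, but the inverse of \<open>R\<close> after an
  occurrence of \<open>einv e\<close>: \<open>sg\<close> records the sign and \<open>brk\<close> the place of the insertion.\<close>

definition sg :: "edge \<Rightarrow> edge \<Rightarrow> real" where
  "sg e f = (if f = e then 1 else if f = einv e then -1 else 0)"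

definition brk :: "edge \<Rightarrow> edge list \<Rightarrow> nat \<Rightarrow> nat" where
  "brk e w k = (if w ! k = e then k else Suc k)"

text \<open>The entries of the product P X S with X = E_ab - E_ba; for \<open>a = b\<close> it is
  zero.\<close>

definition insX :: "nat \<Rightarrow> nat \<Rightarrow> mat \<Rightarrow> mat \<Rightarrow> mat" where
  "insX a b P S = (\<lambda>i j. P i a * S b j - P i b * S a j)"

definition dhol :: "nat \<Rightarrow> nat \<Rightarrow> edge \<Rightarrow> nat \<Rightarrow> nat \<Rightarrow> (edge \<Rightarrow> mat) \<Rightarrow> edge list \<Rightarrow> mat" where
  "dhol d N e a b Q w = (\<lambda>i j. \<Sum>k<length w. sg e (w ! k) *
     insX a b (hol d N Q (take (brk e w k) w)) (hol d N Q (drop (brk e w k) w)) i j)"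

definition rotate_edge :: "nat \<Rightarrow> edge \<Rightarrow> nat \<Rightarrow> nat \<Rightarrow> real \<Rightarrow> (edge \<Rightarrow> mat) \<Rightarrow> edge \<Rightarrow> mat" where
  "rotate_edge N e a b t Q = Q(e := mmul N (rot N a b t) (Q e))"

lemma insX_mmul_right:
  assumes "b < N" "a < N" "j < N"
  shows "(\<Sum>k<N. insX a b P S i k * H k j) = insX a b P (mmul N S H) i j"
  using assms by (simp add: insX_def mmul_def algebra_simps sum_subtractf sum_distrib_left)

lemma insX_mmul_left:
  assumes "b < N" "a < N" "i < N"
  shows "(\<Sum>k<N. A i k * insX a b P S k j) = insX a b (mmul N A P) S i j"
  using assms by (simp add: insX_def mmul_def algebra_simps sum_subtractf sum_distrib_left sum_distrib_right)

text \<open>For \<open>einv e\<close> the transpose of the rotated matrix moves, and X^T = -X turns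
  X on the left into -X on the right.\<close>

lemma has_derivative_Qof_rotate_edge:
  fixes Q :: "edge \<Rightarrow> mat"
  assumes e: "pos_edge d e" and ab: "a < N" "b < N" "a \<noteq> b" and ij: "i < N" "j < N"
  defines "A \<equiv> \<lambda>t. Qof d (rotate_edge N e a b t Q)"
  shows "((\<lambda>t. A t f i j) has_real_derivative
     (if f = e then insX a b (mid N) (A t f) i j
      else if f = einv e then - insX a b (A t f) (mid N) i j else 0)) (at t)"
proof -
  consider "f = e" | "f = einv e" | "f \<noteq> e" "f \<noteq> einv e" by blast
  then show ?thesis
  proof cases
    case 1
    then have "A t f = mmul N (rot N a b t) (Q e)" for t
      using e by (simp add: A_def Qof_def rotate_edge_def)
    then show ?thesis
      using has_derivative_mmul_rot[OF ab ij, of "Q e" t] 1 by (simp add: insX_def)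
  next
    case 2
    have A: "A t f = mtrans (mmul N (rot N a b t) (Q e))" for t
      using e not_pos_edge_einv[OF e] 2 by (simp add: A_def Qof_def rotate_edge_def)
    have "f \<noteq> e" using 2 e by (metis not_pos_edge_einv)
    moreover have "mid N x y = mid N y x" for x y by (simp add: mid_def)
    ultimately show ?thesis
      unfolding A using has_derivative_mmul_rot[OF ab ij(2,1), of "Q e" t] 2
      by (simp add: insX_def mtrans_def mult.commute)
  next
    case 3
    then have "einv f \<noteq> e" by (metis einv_einv)
    with 3 have "A t f = Qof d Q f" for t by (simp add: A_def Qof_def rotate_edge_def)
    with 3 show ?thesis by simp
  qed
qed

text \<open>The Leibniz rule over the letters, by induction on the word: the head gives the summand
  at position 0, and the tail gives the others with positions shifted by one.\<close>

lemma has_derivative_hol_rotate_edge: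
  assumes e: "pos_edge d e" and ab: "a < N" "b < N" "a \<noteq> b" and ij: "i < N" "j < N"
  shows "((\<lambda>t. hol d N (rotate_edge N e a b t Q) w i j) has_real_derivative
     dhol d N e a b (rotate_edge N e a b t Q) w i j) (at t)"
  using ij
proof (induction w arbitrary: i j)
  case Nil
  then show ?case by (simp add: dhol_def)
next
  case (Cons f w)
  let ?R = "\<lambda>t. rotate_edge N e a b t Q"
  let ?A = "\<lambda>t. Qof d (?R t) f"
  let ?H = "\<lambda>t. hol d N (?R t) w"
  let ?dA = "\<lambda>i j. if f = e then insX a b (mid N) (?A t) i j
      else if f = einv e then - insX a b (?A t) (mid N) i j else 0"
  have ne: "einv e \<noteq> e" using e einv_neq is_edge_def by blast
  \<comment> \<open>For a leading \<open>einv e\<close> the insertion comes after the first letter,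
    and the holonomy of that one-letter prefix is this product. Its support needs nothing about
    \<open>Q\<close>, since the rotated matrix is itself a cut-off product.\<close>
  have *: "mmul N (?A t) (mid N) = ?A t" if "f = einv e"
  proof -
    have "msupp N (?A t)"
      using e not_pos_edge_einv[OF e] that by (simp add: Qof_def rotate_edge_def)
    then show ?thesis by (rule mmul_mid_right)
  qed
  have D: "((\<lambda>t. \<Sum>k<N. ?A t i k * ?H t k j) has_real_derivative
     (\<Sum>k<N. ?dA i k * ?H t k j + dhol d N e a b (?R t) w k j * ?A t i k)) (at t)"
    using Cons.prems
    by (intro DERIV_sum DERIV_mult' DERIV_mult Cons.IH has_derivative_Qof_rotate_edge[OF e ab]) auto
  have "(\<Sum>k<N. ?dA i k * ?H t k j + dhol d N e a b (?R t) w k j * ?A t i k)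
     = (\<Sum>k<N. ?dA i k * ?H t k j) + (\<Sum>k<N. ?A t i k * dhol d N e a b (?R t) w k j)"
    by (simp add: sum.distrib mult.commute)
  also have "(\<Sum>k<N. ?dA i k * ?H t k j) = sg e f * insX a b
      (hol d N (?R t) (take (brk e (f # w) 0) (f # w))) (hol d N (?R t) (drop (brk e (f # w) 0) (f # w))) i j"
    using Cons.prems ab ne * by (simp add: sg_def brk_def insX_mmul_right mmul_mid_left sum_negf)
  also have "(\<Sum>k<N. ?A t i k * dhol d N e a b (?R t) w k j)
     = (\<Sum>m<length w. sg e (w ! m) * (\<Sum>k<N. ?A t i k * insX a b (hol d N (?R t) (take (brk e w m) w))
           (hol d N (?R t) (drop (brk e w m) w)) k j))"
    unfolding dhol_def sum_distrib_left by (subst sum.swap) (simp add: ac_simps)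
  also have "\<dots> = (\<Sum>m<length w. sg e ((f # w) ! Suc m) * insX a b
      (hol d N (?R t) (take (brk e (f # w) (Suc m)) (f # w)))
      (hol d N (?R t) (drop (brk e (f # w) (Suc m)) (f # w))) i j)"
    using Cons.prems ab by (intro sum.cong refl) (simp add: insX_mmul_left brk_def)
  finally have "(\<Sum>k<N. ?dA i k * ?H t k j + dhol d N e a b (?R t) w k j * ?A t i k)
      = dhol d N e a b (?R t) (f # w) i j"
    unfolding dhol_def length_Cons sum.lessThan_Suc_shift by simp
  with D show ?case
    using Cons.prems by (simp add: mmul_def)
qed

text \<open>A coordinate form of the completeness relation of so(N). Since X vanishes for
  \<open>a = b\<close>, the sums may run over all pairs.\<close>

lemma sum_insX_swap:
  "(\<Sum>a<N. \<Sum>b<N. insX a b P S b a) = mtrace N (mmul N (mtrans P) S) - mtrace N P * mtrace N S"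
proof -
  have "(\<Sum>a<N. \<Sum>b<N. insX a b P S b a) = (\<Sum>a<N. \<Sum>b<N. P b a * S b a) - (\<Sum>a<N. \<Sum>b<N. P b b * S a a)"
    by (simp add: insX_def sum_subtractf)
  also have "(\<Sum>a<N. \<Sum>b<N. P b a * S b a) = mtrace N (mmul N (mtrans P) S)"
    unfolding mtrace_mtrans_mmul by (rule sum.swap)
  also have "(\<Sum>a<N. \<Sum>b<N. P b b * S a a) = mtrace N P * mtrace N S"
    unfolding mtrace_def sum_product by (rule sum.swap)
  finally show ?thesis .
qed

lemma sum_insX_diag:
  assumes "a < N" "b < N"
  shows "(\<Sum>i<N. insX a b P S i i) = mmul N S P b a - mmul N S P a b"
  using assms by (simp add: insX_def mmul_def sum_subtractf mult.commute)

definition dW :: "nat \<Rightarrow> nat \<Rightarrow> edge \<Rightarrow> nat \<Rightarrow> nat \<Rightarrow> (edge \<Rightarrow> mat) \<Rightarrow> edge list \<Rightarrow> real" where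
  "dW d N e a b Q v = (\<Sum>k<length v. sg e (v ! k) *
     (hol d N Q (drop (brk e v k) v @ take (brk e v k) v) b a
      - hol d N Q (drop (brk e v k) v @ take (brk e v k) v) a b))"

text \<open>By cyclicity tr(P X S) = tr(X S P), so each occurrence contributes two entries of the
  holonomy of \<open>v\<close> cut open at the insertion place.\<close>

lemma has_derivative_W_rotate_edge:
  assumes e: "pos_edge d e" and ab: "a < N" "b < N" "a \<noteq> b"
  shows "((\<lambda>t. W d N (rotate_edge N e a b t Q) v) has_real_derivative
     dW d N e a b (rotate_edge N e a b t Q) v) (at t)"
proof -
  have "((\<lambda>t. W d N (rotate_edge N e a b t Q) v) has_real_derivative
     (\<Sum>i<N. dhol d N e a b (rotate_edge N e a b t Q) v i i)) (at t)"
    unfolding W_def mtrace_def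
    by (intro DERIV_sum has_derivative_hol_rotate_edge[OF e ab]) auto
  also have "(\<Sum>i<N. dhol d N e a b (rotate_edge N e a b t Q) v i i)
      = dW d N e a b (rotate_edge N e a b t Q) v"
    unfolding dhol_def dW_def
    by (subst sum.swap) (simp add: ab sum_insX_diag hol_append flip: sum_distrib_left)
  finally show ?thesis .
qed

lemma sum_swap3: "(\<Sum>a\<in>A. \<Sum>b\<in>B. \<Sum>k\<in>K. F a b k) = (\<Sum>k\<in>K. \<Sum>a\<in>A. \<Sum>b\<in>B. F a b k)"
  for F :: "'a \<Rightarrow> 'b \<Rightarrow> 'c \<Rightarrow> real"
proof -
  have "(\<Sum>a\<in>A. \<Sum>b\<in>B. \<Sum>k\<in>K. F a b k) = (\<Sum>a\<in>A. \<Sum>k\<in>K. \<Sum>b\<in>B. F a b k)"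
    by (intro sum.cong refl sum.swap)
  also have "\<dots> = (\<Sum>k\<in>K. \<Sum>a\<in>A. \<Sum>b\<in>B. F a b k)" by (rule sum.swap)
  finally show ?thesis .
qed

text \<open>What the derivative of an open holonomy becomes after summing over all planes. The
  single trace, with the initial part reversed, is a twisting of the word; the product of two traces
  is a splitting.\<close>

definition twist :: "nat \<Rightarrow> nat \<Rightarrow> edge \<Rightarrow> (edge \<Rightarrow> mat) \<Rightarrow> edge list \<Rightarrow> real" where
  "twist d N e Q w = (\<Sum>k<length w. sg e (w ! k) *
     (W d N Q (pinv (take (brk e w k) w) @ drop (brk e w k) w)
      - W d N Q (take (brk e w k) w) * W d N Q (drop (brk e w k) w)))"

text \<open>The open word \<open>w\<close> is glued to another cycle \<open>v\<close>, cut at an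
  occurrence of the edge, reversed or not. One expression serves two purposes: for the other loops
  of the sequence it is an error term, for plaquettes it becomes the deformations.\<close>

definition merging :: "nat \<Rightarrow> nat \<Rightarrow> edge \<Rightarrow> (edge \<Rightarrow> mat) \<Rightarrow> edge list \<Rightarrow> edge list \<Rightarrow> real" where
  "merging d N e Q w v = (\<Sum>k<length v. sg e (v ! k) *
     (W d N Q (w @ pinv (drop (brk e v k) v @ take (brk e v k) v))
      - W d N Q (w @ drop (brk e v k) v @ take (brk e v k) v)))"

lemma sum_dhol:
  assumes "\<forall>f\<in>set w. is_edge d f"
  shows "(\<Sum>a<N. \<Sum>b<N. dhol d N e a b Q w b a) = twist d N e Q w"
proof -
  have tr: "hol d N Q (pinv (take k w)) = mtrans (hol d N Q (take k w))" for k
    using assms by (intro hol_pinv) (auto dest: in_set_takeD)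
  have "(\<Sum>a<N. \<Sum>b<N. dhol d N e a b Q w b a) = (\<Sum>k<length w. \<Sum>a<N. \<Sum>b<N. sg e (w ! k) *
     insX a b (hol d N Q (take (brk e w k) w)) (hol d N Q (drop (brk e w k) w)) b a)"
    unfolding dhol_def by (rule sum_swap3)
  also have "\<dots> = twist d N e Q w"
    unfolding twist_def W_def hol_append tr sum_insX_swap[symmetric] sum_distrib_left ..
  finally show ?thesis .
qed

text \<open>Pairing H_ba with V_ba - V_ab and summing gives tr(H V^T) - tr(H V); the transpose is
  the holonomy of the reversed cycle.\<close>

lemma sum_hol_dW:
  assumes "\<forall>f\<in>set v. is_edge d f"
  shows "(\<Sum>a<N. \<Sum>b<N. hol d N Q w b a * dW d N e a b Q v) = merging d N e Q w v"
proof -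
  have c: "(\<Sum>a<N. \<Sum>b<N. H b a * (V b a - V a b))
      = mtrace N (mmul N H (mtrans V)) - mtrace N (mmul N H V)" for H V
  proof -
    have "(\<Sum>a<N. \<Sum>b<N. H b a * (V b a - V a b))
        = (\<Sum>a<N. \<Sum>b<N. H b a * V b a) - (\<Sum>a<N. \<Sum>b<N. H b a * V a b)"
      by (simp add: right_diff_distrib sum_subtractf)
    also have "(\<Sum>a<N. \<Sum>b<N. H b a * V b a) = mtrace N (mmul N H (mtrans V))"
      unfolding mtrace_mmul mtrans_def by (rule sum.swap)
    also have "(\<Sum>a<N. \<Sum>b<N. H b a * V a b) = mtrace N (mmul N H V)"
      unfolding mtrace_mmul by (rule sum.swap)
    finally show ?thesis .
  qed
  have tr: "hol d N Q (pinv (drop k v @ take k v)) = mtrans (hol d N Q (drop k v @ take k v))" for k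
    using assms by (intro hol_pinv) (auto dest: in_set_takeD in_set_dropD)
  have "(\<Sum>a<N. \<Sum>b<N. hol d N Q w b a * dW d N e a b Q v)
     = (\<Sum>k<length v. sg e (v ! k) * (\<Sum>a<N. \<Sum>b<N. hol d N Q w b a *
     (hol d N Q (drop (brk e v k) v @ take (brk e v k) v) b a
      - hol d N Q (drop (brk e v k) v @ take (brk e v k) v) a b)))"
    unfolding dW_def sum_distrib_left
    by (rule trans[OF sum_swap3]) (intro sum.cong refl mult.left_commute)
  also have "\<dots> = merging d N e Q w v"
    unfolding c merging_def W_def by (simp only: hol_append[of d N Q w] tr)
  finally show ?thesis .
qed

subsection \<open>Integration by parts\<close>

lemma step_vtx [simp]: "x \<in> vtx d \<Longrightarrow> step x i \<in> vtx d"
  by (simp add: vtx_def step_def)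

lemma pos_edge_step: "x \<in> vtx d \<Longrightarrow> i < d \<Longrightarrow> pos_edge d (x, step x i)"
  by (auto simp: pos_edge_def)

lemma plaq_pos_edges:
  assumes "x \<in> vtx d" "i < j" "j < d"
  shows "pos_edge d (x, step x i)" "pos_edge d (step x i, step (step x i) j)"
    "pos_edge d (step x j, step (step x i) j)" "pos_edge d (x, step x j)"
proof -
  have "step (step x i) j = step (step x j) i"
    using assms by (simp add: step_def list_update_swap)
  then show "pos_edge d (step x j, step (step x i) j)"
    using assms pos_edge_step[of "step x j" d i] by simp
qed (use assms pos_edge_step in auto)

section \<open>The finite-volume measure and bounded observables\<close>

locale lattice_gauge =
  fixes d N :: nat and L :: "vertex set" and \<beta> :: real and \<sigma> :: "mat measure"
  assumes finite_L: "finite L" and haar: "haar_SO N \<sigma>"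
begin

abbreviation "E \<equiv> Epos_L d L"
abbreviation "M \<equiv> PiM E (\<lambda>_. \<sigma>)"
abbreviation "g \<equiv> gauge_weight d L N \<beta>"
abbreviation "EV \<equiv> lgt_expect d L N \<beta> \<sigma>"

text \<open>Points of the product space are \<open>undefined\<close> off \<open>E\<close>, so
  holonomies are controlled only for words whose edges, up to orientation, lie in
  \<open>E\<close>.\<close>

definition supported :: "edge list \<Rightarrow> bool" where
  "supported l \<longleftrightarrow> (\<forall>f\<in>set l. f \<in> E \<or> einv f \<in> E)"

text \<open>The almost sure event on which bounds hold. Rotating an edge variable does not leave it,
  so bounds at \<open>Q\<close> persist along the whole rotation.\<close>

definition conf :: "(edge \<Rightarrow> mat) \<Rightarrow> bool" where
  "conf Q \<longleftrightarrow> (\<forall>e\<in>E. orth N (Q e))"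

text \<open>Boundedness is asked only on \<open>conf\<close>, because matrix entries are unbounded
  on the full product space. The class is closed under sums, products and exp, and almost sure
  boundedness makes its members integrable.\<close>

definition nice :: "((edge \<Rightarrow> mat) \<Rightarrow> real) \<Rightarrow> bool" where
  "nice F \<longleftrightarrow> F \<in> borel_measurable M \<and> (\<exists>C. \<forall>Q. conf Q \<longrightarrow> \<bar>F Q\<bar> \<le> C)"

lemma finite_E: "finite E"
  by (rule finite_subset[of _ "L \<times> L"]) (auto simp: Epos_L_def finite_L)

lemma E_pos: "e \<in> E \<Longrightarrow> pos_edge d e"
  by (simp add: Epos_L_def)

lemma supported_is_edge: "supported l \<Longrightarrow> \<forall>f\<in>set l. is_edge d f"
  by (auto simp: supported_def is_edge_def dest: E_pos)

lemma supported_simps [simp]: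
  "supported []"
  "supported (f # l) \<longleftrightarrow> (f \<in> E \<or> einv f \<in> E) \<and> supported l"
  "supported (u @ v) \<longleftrightarrow> supported u \<and> supported v"
  "supported (pinv l) \<longleftrightarrow> supported l"
  by (auto simp: supported_def)

lemma supported_subset: "supported l \<Longrightarrow> set k \<subseteq> set l \<Longrightarrow> supported k"
  by (auto simp: supported_def)

lemma supported_take_drop [simp]: "supported l \<Longrightarrow> supported (take k l)" "supported l \<Longrightarrow> supported (drop k l)"
  by (meson supported_subset set_take_subset set_drop_subset)+

lemma orth_on_conf: assumes "conf Q" "supported l" shows "orth_on d N Q l"
  unfolding orth_on_def
proof
  fix f assume f: "f \<in> set l"
  then have i: "is_edge d f" using supported_is_edge[OF assms(2)] by blast
  from f assms(2) have "f \<in> E \<or> einv f \<in> E" by (auto simp: supported_def)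
  then have "orth N (Qof d Q f)"
  proof
    assume "f \<in> E"
    then show ?thesis using assms(1) E_pos by (simp add: conf_def Qof_def)
  next
    assume e: "einv f \<in> E"
    then have "\<not> pos_edge d f" using not_pos_edge_einv[OF E_pos[OF e]] by simp
    then show ?thesis using assms(1) e by (simp add: conf_def Qof_def orth_mtrans)
  qed
  with i show "is_edge d f \<and> orth N (Qof d Q f)" ..
qed

lemma finite_Pplus_L: "finite (Pplus_L d L)"
  and supported_Pplus_L: "p \<in> Pplus_L d L \<Longrightarrow> supported p"
proof -
  have *: "set p \<subseteq> L \<times> L \<and> length p = 4 \<and> supported p" if pL: "p \<in> Pplus_L d L" for p
  proof -
    obtain x i j where p: "p = plaq x i j" "x \<in> vtx d" "i < j" "j < d" and L: "\<forall>f\<in>set p. fst f \<in> L"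
      using pL by (auto simp: Pplus_L_def Pplus_def)
    note plaq_pos_edges[OF p(2-4)]
    then show ?thesis
      using L p(1) by (auto simp: plaq_def supported_def Epos_L_def einv_def)
  qed
  show "finite (Pplus_L d L)"
    using finite_lists_length_eq[of "L \<times> L" 4] finite_L * by (auto intro: finite_subset[rotated])
  show "p \<in> Pplus_L d L \<Longrightarrow> supported p" using * by blast
qed

lemma prob_space_\<sigma>: "prob_space \<sigma>" and sets_\<sigma>: "sets \<sigma> = sets borel"
  using haar by (auto simp: haar_SO_def)

sublocale M: prob_space M
  by (intro prob_space_PiM prob_space_\<sigma>)

lemma AE_conf: "AE Q in M. conf Q"
proof -
  interpret s: prob_space \<sigma> by (rule prob_space_\<sigma>)
  have "emeasure \<sigma> (SO N) = 1" using haar by (simp add: haar_SO_def)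
  then have "AE A in \<sigma>. A \<in> SO N"
    by (intro s.AE_prob_1) (simp add: measure_def)
  then have "AE A in \<sigma>. orth N A" by (rule AE_mp) (auto intro: orth_SO)
  then have "AE Q in M. orth N (Q e)" if "e \<in> E" for e
    using that prob_space_\<sigma> by (intro AE_PiM_component)
  then show ?thesis
    unfolding conf_def using finite_E by (simp add: AE_finite_all)
qed

lemma measurable_entry: "(\<lambda>A. A i j) \<in> borel_measurable (borel :: mat measure)"
  by (rule measurable_compose[OF measurable_product_coordinates measurable_product_coordinates])

lemma measurable_mmul: "(\<lambda>A. mmul N B A) \<in> borel_measurable borel"
  unfolding mmul_def
  by (intro measurable_coordinatewise_then_product measurable_If borel_measurable_sum
      borel_measurable_times measurable_entry) auto

text \<open>Edges outside \<open>E\<close> have to be covered too, since a word may mention them;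
  there the coordinate is constant on the space of \<open>M\<close>.\<close>

lemma measurable_Q_entry: "(\<lambda>Q. Q e i j) \<in> borel_measurable M"
proof (cases "e \<in> E")
  case True
  have "(\<lambda>Q. Q e) \<in> measurable M \<sigma>" using True by simp
  then have "(\<lambda>Q. Q e) \<in> measurable M borel" using sets_\<sigma> by (simp cong: measurable_cong_sets)
  then show ?thesis by (rule measurable_compose[OF _ measurable_entry])
next
  case False
  then have "Q e i j = (undefined :: mat) i j" if "Q \<in> space M" for Q
    using PiE_arb[of Q E "\<lambda>_. space \<sigma>" e] that by (simp add: space_PiM)
  then have "(\<lambda>Q. Q e i j) \<in> borel_measurable M \<longleftrightarrow> (\<lambda>Q. (undefined :: mat) i j) \<in> borel_measurable M"
    by (rule measurable_cong)
  then show ?thesis by simp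
qed

lemma measurable_hol: "(\<lambda>Q. hol d N Q l i j) \<in> borel_measurable M"
proof (induction l arbitrary: i j)
  case (Cons f l)
  have "(\<lambda>Q. Qof d Q f i k) \<in> borel_measurable M" for i k
    by (cases "pos_edge d f") (simp_all add: Qof_def mtrans_def measurable_Q_entry)
  with Cons show ?case by (simp add: mmul_def)
qed simp

lemma niceI: "F \<in> borel_measurable M \<Longrightarrow> (\<And>Q. conf Q \<Longrightarrow> \<bar>F Q\<bar> \<le> C) \<Longrightarrow> nice F"
  unfolding nice_def by blast

lemma nice_measurable: "nice F \<Longrightarrow> F \<in> borel_measurable M"
  by (simp add: nice_def)

lemma niceE: assumes "nice F" obtains C where "\<forall>Q. conf Q \<longrightarrow> \<bar>F Q\<bar> \<le> C" "0 \<le> C"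
proof -
  obtain C where "\<And>Q. conf Q \<Longrightarrow> \<bar>F Q\<bar> \<le> C" using assms by (auto simp: nice_def)
  then have "\<forall>Q. conf Q \<longrightarrow> \<bar>F Q\<bar> \<le> max C 0" by (simp add: max.coboundedI1)
  with that show thesis by (metis max.cobounded2)
qed

lemma nice_const: "nice (\<lambda>_. c)"
  by (rule niceI[of _ "\<bar>c\<bar>"]) auto

lemma nice_add: assumes "nice F" "nice G" shows "nice (\<lambda>Q. F Q + G Q)"
proof -
  obtain A B where "\<And>Q. conf Q \<Longrightarrow> \<bar>F Q\<bar> \<le> A" "\<And>Q. conf Q \<Longrightarrow> \<bar>G Q\<bar> \<le> B"
    using assms by (metis niceE)
  then have "conf Q \<Longrightarrow> \<bar>F Q + G Q\<bar> \<le> A + B" for Q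
    using abs_triangle_ineq[of "F Q" "G Q"] by fastforce
  then show ?thesis
    by (rule niceI[OF borel_measurable_add[OF assms[THEN nice_measurable]]])
qed

lemma nice_mult: assumes "nice F" "nice G" shows "nice (\<lambda>Q. F Q * G Q)"
proof -
  obtain A B where *: "\<And>Q. conf Q \<Longrightarrow> \<bar>F Q\<bar> \<le> A" "\<And>Q. conf Q \<Longrightarrow> \<bar>G Q\<bar> \<le> B" "0 \<le> A"
    using assms by (metis niceE)
  then have "conf Q \<Longrightarrow> \<bar>F Q * G Q\<bar> \<le> A * B" for Q
    unfolding abs_mult by (intro mult_mono) auto
  then show ?thesis
    by (rule niceI[OF borel_measurable_times[OF assms[THEN nice_measurable]]])
qed

lemma nice_diff: "nice F \<Longrightarrow> nice G \<Longrightarrow> nice (\<lambda>Q. F Q - G Q)"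
  using nice_add[of F "\<lambda>Q. (-1) * G Q"] nice_mult[OF nice_const[of "-1"], of G] by simp

lemma nice_sum: "(\<And>x. x \<in> X \<Longrightarrow> nice (F x)) \<Longrightarrow> nice (\<lambda>Q. \<Sum>x\<in>X. F x Q)"
  by (induction X rule: infinite_finite_induct) (auto intro: nice_add nice_const)

lemma nice_prod: "(\<And>x. x \<in> X \<Longrightarrow> nice (F x)) \<Longrightarrow> nice (\<lambda>Q. \<Prod>x\<in>X. F x Q)"
  by (induction X rule: infinite_finite_induct) (auto intro: nice_mult nice_const)

lemma nice_exp: assumes "nice F" shows "nice (\<lambda>Q. exp (F Q))"
proof -
  obtain A where "\<And>Q. conf Q \<Longrightarrow> \<bar>F Q\<bar> \<le> A" using assms by (metis niceE)
  then have "conf Q \<Longrightarrow> \<bar>exp (F Q)\<bar> \<le> exp A" for Q by fastforce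
  moreover have "(\<lambda>Q. exp (F Q)) \<in> borel_measurable M"
    using nice_measurable[OF assms] by measurable
  ultimately show ?thesis by (intro niceI)
qed

lemma nice_hol: "supported l \<Longrightarrow> nice (\<lambda>Q. hol d N Q l i j)"
  by (rule niceI[of _ 1]) (auto simp: measurable_hol intro!: orth_entry_le orth_hol orth_on_conf)

lemma nice_W: "supported l \<Longrightarrow> nice (\<lambda>Q. W d N Q l)"
  unfolding W_def mtrace_def by (intro nice_sum nice_hol)

lemma nice_g: "nice g"
  unfolding gauge_weight_def using supported_Pplus_L
  by (intro nice_exp nice_mult nice_const nice_sum nice_W) auto

lemma nice_integrable: assumes "nice F" shows "integrable M F"
proof -
  obtain C where "\<And>Q. conf Q \<Longrightarrow> \<bar>F Q\<bar> \<le> C" using assms by (metis niceE)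
  then have "AE Q in M. norm (F Q) \<le> C"
    using AE_conf by (auto elim!: AE_mp)
  then show ?thesis using assms by (intro M.integrable_const_bound) (auto simp: nice_measurable)
qed

section \<open>Invariance of the product Haar measure and integration by parts\<close>

lemma distr_update:
  assumes e: "e \<in> E" and B: "B \<in> SO N"
  shows "distr M M (\<lambda>Q. Q(e := mmul N B (Q e))) = M"
    and "(\<lambda>Q. Q(e := mmul N B (Q e))) \<in> measurable M M"
proof -
  interpret s: product_prob_space "\<lambda>_::edge. \<sigma>" E
    by (intro product_prob_spaceI prob_space_\<sigma>)
  let ?T = "\<lambda>Q. Q(e := mmul N B (Q e))"
  have mm: "mmul N B \<in> measurable \<sigma> \<sigma>"
    using measurable_mmul[of B] sets_\<sigma> by (simp cong: measurable_cong_sets)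
  have T: "?T \<in> measurable M M"
  proof (rule measurable_PiM_single')
    show "(\<lambda>Q. ?T Q i) \<in> measurable M \<sigma>" if "i \<in> E" for i
      using that measurable_compose[OF measurable_component_singleton[of e E "\<lambda>_. \<sigma>"] mm] e
      by (cases "i = e") simp_all
    show "?T \<in> space M \<rightarrow> (\<Pi>\<^sub>E i\<in>E. space \<sigma>)"
      using e measurable_space[OF mm] by (auto simp: space_PiM PiE_def extensional_def Pi_iff)
  qed
  show "?T \<in> measurable M M" by (rule T)
  show "distr M M ?T = M"
  proof (rule s.PiM_eqI[OF finite_E])
    fix A assume A: "\<And>i. i \<in> E \<Longrightarrow> A i \<in> sets \<sigma>"
    define A' where "A' = A(e := mmul N B -` A e \<inter> space \<sigma>)"
    have A': "A' i \<in> sets \<sigma>" if "i \<in> E" for i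
      using A[OF that] measurable_sets[OF mm] that by (auto simp: A'_def)
    have eq: "emeasure \<sigma> (A' i) = emeasure \<sigma> (A i)" if "i \<in> E" for i
    proof (cases "i = e")
      case True
      have "distr \<sigma> borel (mmul N B) = \<sigma>" using haar B by (auto simp: haar_SO_def)
      moreover have "distr \<sigma> borel (mmul N B) = distr \<sigma> \<sigma> (mmul N B)"
        using sets_\<sigma> by (intro distr_cong) auto
      ultimately have "emeasure \<sigma> (A e) = emeasure (distr \<sigma> \<sigma> (mmul N B)) (A e)" by simp
      also have "\<dots> = emeasure \<sigma> (mmul N B -` A e \<inter> space \<sigma>)"
        using A e mm by (simp add: emeasure_distr)
      finally show ?thesis using True by (simp add: A'_def)
    qed (simp add: A'_def)
    \<comment> \<open>The preimage of a box is again a box, in which only the factor at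
      \<open>e\<close> is replaced by its preimage under multiplication by \<open>B\<close>. Left
      invariance preserves the measure of that factor, and boxes determine the product
      measure.\<close>
    have "?T -` Pi\<^sub>E E A \<inter> space M = Pi\<^sub>E E A'"
    proof (intro set_eqI iffI)
      fix Q assume "Q \<in> ?T -` Pi\<^sub>E E A \<inter> space M"
      then have T: "?T Q \<in> Pi\<^sub>E E A" and Q: "Q \<in> Pi\<^sub>E E (\<lambda>_. space \<sigma>)" by (auto simp: space_PiM)
      show "Q \<in> Pi\<^sub>E E A'"
      proof (rule PiE_I)
        show "Q i \<in> A' i" if "i \<in> E" for i
          using PiE_mem[OF T that] PiE_mem[OF Q that] by (cases "i = e") (simp_all add: A'_def)
      qed (rule PiE_arb[OF Q])
    next
      fix Q assume Q: "Q \<in> Pi\<^sub>E E A'"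
      have "Q i \<in> space \<sigma>" if "i \<in> E" for i
        using sets.sets_into_space[OF A'[OF that]] PiE_mem[OF Q that] by blast
      then have "Q \<in> space M"
        unfolding space_PiM by (intro PiE_I PiE_arb[OF Q])
      moreover have "?T Q \<in> Pi\<^sub>E E A"
      proof (rule PiE_I)
        show "?T Q i \<in> A i" if "i \<in> E" for i
          using PiE_mem[OF Q that] by (cases "i = e") (simp_all add: A'_def)
        show "?T Q i = undefined" if "i \<notin> E" for i
          using PiE_arb[OF Q that] that e by auto
      qed
      ultimately show "Q \<in> ?T -` Pi\<^sub>E E A \<inter> space M" by blast
    qed
    moreover have "emeasure (distr M M ?T) (Pi\<^sub>E E A) = emeasure M (?T -` Pi\<^sub>E E A \<inter> space M)"
      using T A finite_E by (intro emeasure_distr sets_PiM_I_finite)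
    ultimately show "emeasure (distr M M ?T) (Pi\<^sub>E E A) = (\<Prod>i\<in>E. emeasure \<sigma> (A i))"
      using A' finite_E eq by (simp add: s.emeasure_PiM)
  qed simp
qed

lemma conf_rotate_edge:
  assumes "conf Q" "a < N" "b < N" "a \<noteq> b"
  shows "conf (rotate_edge N e a b t Q)"
  using assms orth_mmul[OF orth_SO[OF rot_SO]] by (auto simp: conf_def rotate_edge_def)

text \<open>By invariance every difference quotient has integral zero. The mean value theorem bounds
  it by a bound for \<open>F'\<close> on \<open>conf\<close>, so dominated convergence carries the
  zero over to the derivative.\<close>

lemma integral_derivative_rotate_edge:
  assumes e: "e \<in> E" and ab: "a < N" "b < N" "a \<noteq> b" and F: "nice F" and F': "nice F'"
    and D: "\<And>Q t. ((\<lambda>t. F (rotate_edge N e a b t Q)) has_real_derivative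
              F' (rotate_edge N e a b t Q)) (at t)"
  shows "(\<integral>Q. F' Q \<partial>M) = 0"
proof -
  let ?R = "rotate_edge N e a b"
  define h where "h n = 1 / real (Suc n)" for n
  have h: "h n > 0" for n by (simp add: h_def)
  define q where "q n Q = (F (?R (h n) Q) - F Q) / h n" for n Q
  obtain C where C: "\<forall>Q. conf Q \<longrightarrow> \<bar>F' Q\<bar> \<le> C" "0 \<le> C" by (rule niceE[OF F'])
  have RT: "?R t = (\<lambda>Q. Q(e := mmul N (rot N a b t) (Q e)))" for t
    by (rule ext) (simp only: rotate_edge_def)
  have Rm: "?R t \<in> measurable M M" for t
    unfolding RT by (rule distr_update(2)[OF e rot_SO[OF ab]])
  have FR: "(\<lambda>Q. F (?R t Q)) \<in> borel_measurable M" for t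
    by (rule measurable_compose[OF Rm nice_measurable[OF F]])
  have inv: "(\<integral>Q. F (?R t Q) \<partial>M) = (\<integral>Q. F Q \<partial>M)" for t
  proof -
    have "(\<integral>Q. F Q \<partial>M) = (\<integral>Q. F Q \<partial>(distr M M (?R t)))"
      unfolding RT distr_update(1)[OF e rot_SO[OF ab]] ..
    also have "\<dots> = (\<integral>Q. F (?R t Q) \<partial>M)"
      by (rule integral_distr[OF Rm nice_measurable[OF F]])
    finally show ?thesis ..
  qed
  obtain CF where CF: "\<forall>Q. conf Q \<longrightarrow> \<bar>F Q\<bar> \<le> CF" "0 \<le> CF" by (rule niceE[OF F])
  have FRi: "integrable M (\<lambda>Q. F (?R t Q))" for t
  proof (rule M.integrable_const_bound[of _ CF])
    show "AE Q in M. norm (F (?R t Q)) \<le> CF"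
      using AE_conf by (rule AE_mp) (auto intro!: AE_I2 CF(1)[rule_format] conf_rotate_edge ab)
  qed (rule FR)
  have q0: "(\<integral>Q. q n Q \<partial>M) = 0" for n
    unfolding q_def using inv[of "h n"] FRi[of "h n"] nice_integrable[OF F] by simp
  \<comment> \<open>Rotation by the angle 0 still multiplies by \<open>mid N\<close>, which fixes
    only matrices with the right support; hence the restriction to \<open>conf\<close>.\<close>
  have R0: "?R 0 Q = Q" if "conf Q" for Q
    using that e by (auto simp: rotate_edge_def rot_0 conf_def orth_def mmul_mid_left)
  have "(\<lambda>n. \<integral>Q. q n Q \<partial>M) \<longlonglongrightarrow> (\<integral>Q. F' Q \<partial>M)"
  proof (rule integral_dominated_convergence[where w = "\<lambda>_. C"])
    show "AE Q in M. (\<lambda>n. q n Q) \<longlonglongrightarrow> F' Q"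
      using AE_conf
    proof (rule AE_mp, intro AE_I2 impI)
      fix Q assume Q: "conf Q"
      have "((\<lambda>s. (F (?R s Q) - F (?R 0 Q)) / (s - 0)) \<longlongrightarrow> F' (?R 0 Q)) (at 0)"
        using D[of Q 0] by (simp add: has_field_derivative_iff)
      moreover have "filterlim h (at 0) sequentially"
        unfolding h_def filterlim_at
        using LIMSEQ_inverse_real_of_nat by (auto simp: inverse_eq_divide)
      ultimately show "(\<lambda>n. q n Q) \<longlonglongrightarrow> F' Q"
        unfolding q_def R0[OF Q] by (auto dest: filterlim_compose)
    qed
    show "AE Q in M. norm (q n Q) \<le> C" for n
      using AE_conf
    proof (rule AE_mp, intro AE_I2 impI)
      fix Q assume Q: "conf Q"
      \<comment> \<open>The intermediate angle depends on \<open>Q\<close> and \<open>n\<close>,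
        which is harmless because the bound on \<open>F'\<close> holds at every rotated
        configuration.\<close>
      obtain z where "F (?R (h n) Q) - F (?R 0 Q) = (h n - 0) * F' (?R z Q)"
        using MVT2[OF h[of n], of "\<lambda>t. F (?R t Q)" "\<lambda>t. F' (?R t Q)"] D by blast
      then have "q n Q = F' (?R z Q)" using h[of n] by (simp add: q_def R0[OF Q])
      then show "norm (q n Q) \<le> C" using C(1) conf_rotate_edge[OF Q ab] by simp
    qed
  qed (use FR nice_measurable[OF F] nice_measurable[OF F'] in \<open>auto simp: q_def\<close>)
  then show ?thesis using q0 by (simp add: LIMSEQ_const_iff)
qed

lemma nice_dhol: "supported w \<Longrightarrow> nice (\<lambda>Q. dhol d N e a b Q w i j)"
  unfolding dhol_def insX_def
  by (intro nice_sum nice_mult nice_const nice_diff nice_hol supported_take_drop)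

lemma nice_dW: "supported w \<Longrightarrow> nice (\<lambda>Q. dW d N e a b Q w)"
  unfolding dW_def
  by (intro nice_sum nice_mult nice_const nice_diff nice_hol) auto

text \<open>The three groups are the product rule applied to the open holonomy, the closed loops
  \<open>ls\<close> and the weight, the last bringing down \<open>N * \<beta>\<close> from the
  exponent. Contraction over all planes has already been carried out.\<close>

theorem schwinger_dyson:
  assumes e: "e \<in> E" and w: "supported w" and ls: "\<And>i. i < n \<Longrightarrow> supported (ls ! i)"
  shows "(\<integral>Q. (twist d N e Q w * (\<Prod>i<n. W d N Q (ls ! i))
      + (\<Sum>i<n. merging d N e Q w (ls ! i) * (\<Prod>j\<in>{..<n} - {i}. W d N Q (ls ! j)))
      + real N * \<beta> * (\<Sum>p\<in>Pplus_L d L. merging d N e Q w p) * (\<Prod>i<n. W d N Q (ls ! i))) * g Q \<partial>M) = 0"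
    (is "(\<integral>Q. ?G Q \<partial>M) = 0")
proof -
  let ?P = "\<lambda>Q. \<Prod>i<n. W d N Q (ls ! i)"
  define D where "D a b Q =
     dhol d N e a b Q w b a * (?P Q * g Q)
     + (hol d N Q w b a * (\<Sum>i<n. dW d N e a b Q (ls ! i) * (\<Prod>j\<in>{..<n} - {i}. W d N Q (ls ! j)))) * g Q
     + (hol d N Q w b a * (\<Sum>p\<in>Pplus_L d L. dW d N e a b Q p)) * (real N * \<beta> * ?P Q * g Q)" for a b Q
  have nD: "nice (D a b)" for a b
    unfolding D_def using ls w supported_Pplus_L
    by (intro nice_add nice_mult nice_dhol nice_hol nice_sum nice_prod nice_g nice_W nice_dW nice_const) auto
  have D0: "(\<integral>Q. D a b Q \<partial>M) = 0" if ab: "a < N" "b < N" for a b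
  proof (cases "a = b")
    case True
    \<comment> \<open>There is no rotation plane for equal indices, but X is then zero and every
      summand disappears.\<close>
    then have "D a b Q = 0" for Q by (simp add: D_def dhol_def dW_def insX_def)
    then show ?thesis by simp
  next
    case False
    note pos = E_pos[OF e]
    have "nice (\<lambda>Q. hol d N Q w b a * (?P Q * g Q))"
      using ls w by (intro nice_mult nice_hol nice_prod nice_g nice_W) auto
    moreover have "((\<lambda>t. hol d N (rotate_edge N e a b t Q) w b a * (?P (rotate_edge N e a b t Q) * g (rotate_edge N e a b t Q)))
      has_real_derivative D a b (rotate_edge N e a b t Q)) (at t)" for Q t
    proof -
      note 1 = has_derivative_hol_rotate_edge[OF pos ab False ab(2,1), of Q w t]
      note 2 = has_field_derivative_prod[of "{..<n}" "\<lambda>i t. W d N (rotate_edge N e a b t Q) (ls ! i)",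
         OF has_derivative_W_rotate_edge[OF pos ab False], of t]
      have "((\<lambda>t. real N * \<beta> * (\<Sum>p\<in>Pplus_L d L. W d N (rotate_edge N e a b t Q) p)) has_real_derivative
          real N * \<beta> * (\<Sum>p\<in>Pplus_L d L. dW d N e a b (rotate_edge N e a b t Q) p)) (at t)"
        by (intro DERIV_cmult DERIV_sum has_derivative_W_rotate_edge[OF pos ab False])
      note 3 = DERIV_fun_exp[OF this]
      show ?thesis
        unfolding gauge_weight_def
        by (rule DERIV_cong[OF DERIV_mult[OF 1 DERIV_mult[OF 2 3]]])
          (simp add: D_def gauge_weight_def algebra_simps)
    qed
    ultimately show ?thesis
      by (intro integral_derivative_rotate_edge[OF e ab False _ nD])
  qed
  have sumD: "(\<Sum>a<N. \<Sum>b<N. D a b Q) = ?G Q" for Q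
  proof -
    \<comment> \<open>The free factor \<open>c\<close> lets the same identity serve both uses: the
      product of the remaining loops for \<open>ls\<close>, and the constant 1 for the plaquettes of
      the weight.\<close>
    have A: "(\<Sum>a<N. \<Sum>b<N. hol d N Q w b a * (\<Sum>x\<in>X. dW d N e a b Q (v x) * c x))
        = (\<Sum>x\<in>X. merging d N e Q w (v x) * c x)" if "\<And>x. x \<in> X \<Longrightarrow> supported (v x)"
      for X :: "'i set" and v c
    proof -
      have "(\<Sum>a<N. \<Sum>b<N. hol d N Q w b a * (\<Sum>x\<in>X. dW d N e a b Q (v x) * c x))
        = (\<Sum>x\<in>X. \<Sum>a<N. \<Sum>b<N. hol d N Q w b a * dW d N e a b Q (v x) * c x)"
        unfolding sum_distrib_left mult.assoc[symmetric] by (rule sum_swap3)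
      also have "\<dots> = (\<Sum>x\<in>X. (\<Sum>a<N. \<Sum>b<N. hol d N Q w b a * dW d N e a b Q (v x)) * c x)"
        unfolding sum_distrib_right ..
      also have "\<dots> = (\<Sum>x\<in>X. merging d N e Q w (v x) * c x)"
        by (intro sum.cong refl) (simp only: sum_hol_dW[OF supported_is_edge[OF that]])
      finally show ?thesis .
    qed
    have "(\<Sum>a<N. \<Sum>b<N. D a b Q) =
       (\<Sum>a<N. \<Sum>b<N. dhol d N e a b Q w b a) * (?P Q * g Q)
     + (\<Sum>a<N. \<Sum>b<N. hol d N Q w b a * (\<Sum>i<n. dW d N e a b Q (ls ! i) * (\<Prod>j\<in>{..<n} - {i}. W d N Q (ls ! j)))) * g Q
     + (\<Sum>a<N. \<Sum>b<N. hol d N Q w b a * (\<Sum>p\<in>Pplus_L d L. dW d N e a b Q p * 1)) * (real N * \<beta> * ?P Q * g Q)"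
      by (simp only: D_def sum.distrib sum_distrib_right mult_1_right)
    also have "\<dots> = ?G Q"
      by (subst A, use ls in blast, subst A, use supported_Pplus_L in blast)
        (simp add: sum_dhol supported_is_edge[OF w] algebra_simps)
    finally show ?thesis .
  qed
  have "(\<integral>Q. ?G Q \<partial>M) = (\<integral>Q. (\<Sum>a<N. \<Sum>b<N. D a b Q) \<partial>M)" by (simp only: sumD)
  also have "\<dots> = (\<Sum>a<N. \<Sum>b<N. \<integral>Q. D a b Q \<partial>M)"
    by (subst Bochner_Integration.integral_sum)
      (auto intro!: nice_integrable nD sum.cong Bochner_Integration.integral_sum Bochner_Integration.integrable_sum)
  also have "\<dots> = 0" using D0 by simp
  finally show ?thesis .
qed

section \<open>Expectations under the gauge measure\<close>

lemma g_pos: "g Q > 0"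
  by (simp add: gauge_weight_def)

lemma integral_g_pos: "(\<integral>Q. g Q \<partial>M) > 0"
proof -
  have "(\<integral>Q. g Q \<partial>M) \<noteq> 0"
  proof
    assume "(\<integral>Q. g Q \<partial>M) = 0"
    then have "AE Q in M. g Q = 0"
      using integral_nonneg_eq_0_iff_AE[OF nice_integrable[OF nice_g]] by (simp add: less_imp_le[OF g_pos])
    moreover have "g Q = 0 \<longleftrightarrow> False" for Q using g_pos[of Q] by simp
    ultimately have "AE Q in M. False" by (simp only:)
    then show False by simp
  qed
  moreover have "(\<integral>Q. g Q \<partial>M) \<ge> 0"
    by (intro integral_nonneg_AE AE_I2 less_imp_le g_pos)
  ultimately show ?thesis by simp
qed

lemma EV_add: "nice F \<Longrightarrow> nice G \<Longrightarrow> EV (\<lambda>Q. F Q + G Q) = EV F + EV G"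
  unfolding lgt_expect_def
  by (simp add: distrib_right add_divide_distrib Bochner_Integration.integral_add nice_integrable nice_mult nice_g)

lemma EV_cmult: "EV (\<lambda>Q. c * F Q) = c * EV F"
  unfolding lgt_expect_def by (simp add: mult.assoc)

lemma EV_const: "EV (\<lambda>Q. c) = c"
  unfolding lgt_expect_def using integral_g_pos by simp

lemma EV_sum: "(\<And>x. x \<in> X \<Longrightarrow> nice (F x)) \<Longrightarrow> EV (\<lambda>Q. \<Sum>x\<in>X. F x Q) = (\<Sum>x\<in>X. EV (F x))"
  by (induction X rule: infinite_finite_induct) (auto simp: EV_const EV_add nice_sum)

lemma EV_mono:
  assumes "nice F" "nice G" "\<And>Q. conf Q \<Longrightarrow> F Q \<le> G Q"
  shows "EV F \<le> EV G"
  unfolding lgt_expect_def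
proof (intro divide_right_mono integral_mono_AE nice_integrable nice_mult nice_g assms)
  show "AE Q in M. F Q * g Q \<le> G Q * g Q"
    using AE_conf by (rule AE_mp) (intro AE_I2 impI mult_right_mono assms(3) less_imp_le[OF g_pos])
qed (use integral_g_pos in simp)

lemma EV_abs_le:
  assumes "nice F" "\<And>Q. conf Q \<Longrightarrow> \<bar>F Q\<bar> \<le> C" shows "\<bar>EV F\<bar> \<le> C"
  using EV_mono[OF assms(1) nice_const[of C]] EV_mono[OF nice_const[of "-C"] assms(1)] assms(2)
  by (fastforce simp: EV_const abs_le_iff)

end

subsection \<open>Closed walks and their cores\<close>

text \<open>Explicit endpoints make closed walks accessible to list induction and allow
  concatenation; the empty word, the null loop, is a closed walk at every vertex.\<close>

fun walk :: "nat \<Rightarrow> vertex \<Rightarrow> edge list \<Rightarrow> vertex \<Rightarrow> bool" where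
  "walk d x [] y \<longleftrightarrow> x = y"
| "walk d x (f # l) y \<longleftrightarrow> is_edge d f \<and> fst f = x \<and> walk d (snd f) l y"

lemma walk_append: "walk d x (u @ v) y \<longleftrightarrow> (\<exists>z. walk d x u z \<and> walk d z v y)"
  by (induction u arbitrary: x) auto

lemma walk_pinv: "walk d x l y \<Longrightarrow> walk d y (pinv l) x"
  by (induction l arbitrary: x) (auto simp: pinv_Cons walk_append)

lemma walk_is_edge: "walk d x l y \<Longrightarrow> f \<in> set l \<Longrightarrow> is_edge d f"
  by (induction l arbitrary: x) auto

lemma walk_last: "walk d x l y \<Longrightarrow> l \<noteq> [] \<Longrightarrow> snd (last l) = y"
  by (induction l arbitrary: x) (auto split: if_splits)

lemma walk_nth: "walk d x l y \<Longrightarrow> Suc k < length l \<Longrightarrow> snd (l ! k) = fst (l ! Suc k)"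
proof (induction l arbitrary: x k)
  case (Cons f l)
  then show ?case by (cases k; cases l) auto
qed simp

lemma closed_path_iff_walk: "closed_path d l \<longleftrightarrow> l \<noteq> [] \<and> walk d (fst (hd l)) l (fst (hd l))"
proof
  assume l: "closed_path d l"
  have "walk d (fst (hd m)) m (snd (last m))"
    if "m \<noteq> []" "\<forall>e\<in>set m. is_edge d e" "\<forall>k. Suc k < length m \<longrightarrow> snd (m ! k) = fst (m ! Suc k)" for m
    using that
  proof (induction m rule: induct_list012)
    case (3 e f m)
    have "snd e = fst f" using 3(5)[rule_format, of 0] by simp
    moreover have "\<forall>k. Suc k < length (f # m) \<longrightarrow> snd ((f # m) ! k) = fst ((f # m) ! Suc k)"
      using 3(5) by (metis Suc_less_eq length_Cons nth_Cons_Suc)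
    ultimately show ?case using 3 by simp
  qed simp_all
  from this[of l] l show "l \<noteq> [] \<and> walk d (fst (hd l)) l (fst (hd l))"
    by (simp add: closed_path_def)
next
  assume l: "l \<noteq> [] \<and> walk d (fst (hd l)) l (fst (hd l))"
  then have w: "walk d (fst (hd l)) l (fst (hd l))" and "l \<noteq> []" by simp_all
  then show "closed_path d l"
    unfolding closed_path_def using walk_is_edge[OF w] walk_nth[OF w] walk_last[OF w] by simp
qed

lemma walk_fst_hd: "walk d x l y \<Longrightarrow> l \<noteq> [] \<Longrightarrow> fst (hd l) = x"
  by (cases l) auto

section \<open>Free and cyclic reduction\<close>

lemma freered_Nil [simp]: "freered [] = []"
  and freered_Cons: "freered (e # l) = (case freered l of [] \<Rightarrow> [e]
        | f # r \<Rightarrow> (if f = einv e then r else e # freered l))"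
  by (auto simp: freered_def split: list.splits)

abbreviation nobacktrack :: "edge list \<Rightarrow> bool" where
  "nobacktrack \<equiv> successively (\<lambda>e f. f \<noteq> einv e)"

lemma nobacktrack_freered: "nobacktrack (freered l)"
  by (induction l) (auto simp: freered_Cons successively_Cons split: list.splits)

lemma set_freered: "set (freered l) \<subseteq> set l"
  by (induction l) (auto simp: freered_Cons split: list.splits)

lemma walk_freered: "walk d x l y \<Longrightarrow> walk d x (freered l) y"
proof (induction l arbitrary: x)
  case (Cons e l)
  then have "walk d (snd e) (freered l) y" by simp
  with Cons.prems show ?case by (auto simp: freered_Cons split: list.splits)
qed simp

text \<open>Removing an adjacent inverse pair preserves the matrix itself. Cyclic reduction
  conjugates the matrix, so for it only the trace survives.\<close>

lemma hol_freered: "orth_on d N Q l \<Longrightarrow> hol d N Q (freered l) = hol d N Q l"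
proof (induction l)
  case (Cons e l)
  then have IH: "hol d N Q (freered l) = hol d N Q l" by simp
  show ?case
  proof (cases "freered l")
    case Nil
    then show ?thesis using IH by (simp add: freered_Cons)
  next
    case (Cons f r)
    show ?thesis
    proof (cases "f = einv e")
      case True
      then have "hol d N Q (e # l) = hol d N Q (e # einv e # r)" using IH Cons by simp
      also have "\<dots> = hol d N Q r" using \<open>orth_on d N Q (e # l)\<close> by (intro hol_einv_cancel) auto
      finally show ?thesis using True Cons by (simp add: freered_Cons)
    next
      case False
      then show ?thesis using IH Cons by (simp add: freered_Cons)
    qed
  qed
qed simp

declare cycred.simps [simp del]

lemma cycred_eq: "2 \<le> length l \<and> hd l = einv (last l) \<Longrightarrow> cycred l = cycred (butlast (tl l))"
  and cycred_id: "\<not> (2 \<le> length l \<and> hd l = einv (last l)) \<Longrightarrow> cycred l = l"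
  by (rule trans[OF cycred.simps if_P], assumption, rule trans[OF cycred.simps if_not_P])

lemma cycred_cases:
  assumes "2 \<le> length l" "hd l = einv (last l)"
  obtains f m where "l = einv f # m @ [f]" "butlast (tl l) = m"
proof -
  have "l = hd l # butlast (tl l) @ [last l]"
    using assms(1) by (cases l) (auto split: if_splits)
  with that[of "last l" "butlast (tl l)"] assms(2) show thesis by simp
qed

lemma set_cycred: "set (cycred l) \<subseteq> set l"
proof (induction l rule: cycred.induct)
  case (1 l)
  show ?case
  proof (cases "2 \<le> length l \<and> hd l = einv (last l)")
    case True
    then obtain f m where l: "l = einv f # m @ [f]" "butlast (tl l) = m"
      using cycred_cases by blast
    have "set (cycred l) \<subseteq> set m" using 1[OF True] unfolding cycred_eq[OF True] l(2) .
    then show ?thesis by (auto simp: l(1))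
  qed (simp add: cycred_id)
qed

text \<open>Stripping both ends moves the base point, hence the existential over \<open>y\<close>.
  The last clause rules out a backtrack at the seam, which linear reduction cannot see.\<close>

lemma cycred_props:
  assumes "walk d x l x" "nobacktrack l"
  shows "(\<exists>y. walk d y (cycred l) y) \<and> nobacktrack (cycred l)
    \<and> \<not> (2 \<le> length (cycred l) \<and> hd (cycred l) = einv (last (cycred l)))"
  using assms
proof (induction l arbitrary: x rule: cycred.induct)
  case (1 l)
  show ?case
  proof (cases "2 \<le> length l \<and> hd l = einv (last l)")
    case True
    then obtain f m where l: "l = einv f # m @ [f]" "butlast (tl l) = m"
      using cycred_cases by blast
    have "walk d (fst f) m (fst f)" using "1.prems"(1) by (auto simp: l(1) walk_append)
    moreover have "nobacktrack m" using "1.prems"(2) by (simp add: l(1) successively_Cons successively_append_iff)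
    ultimately show ?thesis
      using "1.IH"[OF True] unfolding cycred_eq[OF True] l(2) by blast
  next
    case False
    then show ?thesis using 1 by (auto simp: cycred_id)
  qed
qed

lemma W_cycred: "orth_on d N Q l \<Longrightarrow> W d N Q (cycred l) = W d N Q l"
proof (induction l rule: cycred.induct)
  case (1 l)
  show ?case
  proof (cases "2 \<le> length l \<and> hd l = einv (last l)")
    case True
    then obtain f m where l: "l = einv f # m @ [f]" "butlast (tl l) = m"
      using cycred_cases by blast
    have "W d N Q l = W d N Q (f # einv f # m)"
      using W_commute[of d N Q "einv f # m" "[f]"] l by simp
    also have "\<dots> = W d N Q m"
      unfolding W_def by (subst hol_einv_cancel) (use "1.prems" l in auto)
    also have "\<dots> = W d N Q (cycred l)"
      using "1.IH"[OF True] "1.prems" unfolding cycred_eq[OF True] l(2) by (simp add: l(1))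
    finally show ?thesis ..
  qed (simp add: cycred_id)
qed

lemma W_core: "orth_on d N Q l \<Longrightarrow> W d N Q (core l) = W d N Q l"
  using W_cycred[of d N Q "freered l"] hol_freered[of d N Q l] set_freered[of l]
  by (simp add: core_def orth_on_subset W_def)

lemma set_core: "set (core l) \<subseteq> set l"
  using set_cycred set_freered unfolding core_def by blast

lemma core_loop:
  assumes "walk d x l x"
  shows "core l = [] \<or> is_loop d (core l)"
proof (cases "core l = []")
  case False
  let ?c = "core l"
  have *: "\<exists>y. walk d y ?c y" "nobacktrack ?c" "\<not> (2 \<le> length ?c \<and> hd ?c = einv (last ?c))"
    using cycred_props[OF walk_freered[OF assms] nobacktrack_freered] by (auto simp: core_def)
  then obtain y where y: "walk d y ?c y" by blast
  then have cp: "closed_path d ?c" using False walk_fst_hd[OF y] by (simp add: closed_path_iff_walk)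
  have "?c ! (Suc k mod length ?c) \<noteq> einv (?c ! k)" if k: "k < length ?c" for k
  proof (cases "Suc k < length ?c")
    case True
    then show ?thesis using *(2) by (simp add: successively_conv_nth)
  next
    case kl: False
    show ?thesis
    proof (cases "length ?c = 1")
      \<comment> \<open>In a one-letter cycle the successor of the letter is the letter itself, so a
        backtrack would make an edge its own inverse.\<close>
      case True
      then have "is_edge d (?c ! k)" using walk_is_edge[OF y] k by simp
      then show ?thesis using einv_neq True k by simp metis
    next
      case F1: False
      have "2 \<le> length ?c" using F1 False by (cases ?c; cases "tl ?c") auto
      moreover have "Suc k = length ?c" using kl k by simp
      then have "?c ! k = last ?c" "?c ! (Suc k mod length ?c) = hd ?c"
        using False by (simp_all add: last_conv_nth hd_conv_nth flip: \<open>Suc k = length ?c\<close>)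
      ultimately show ?thesis using *(3) by simp
    qed
  qed
  then show ?thesis using cp by (simp add: is_loop_def nonbacktracking_def)
qed simp

subsection \<open>Cyclic segments, splittings and deformations\<close>

lemma mod_less_twice: "a < 2 * n \<Longrightarrow> a mod n = (if a < n then a else a - n)" for n :: nat
  by (cases "a < n") (simp_all add: le_mod_geq)

lemma mod_diff_cases: "x < n \<Longrightarrow> m \<le> n \<Longrightarrow> (x + n - m) mod n = (if m \<le> x then x - m else x + n - m)"
  for n :: nat
  by (simp add: mod_less_twice)

text \<open>The letter at location \<open>y\<close> moves to position
  \<open>(y + length l - m) mod length l\<close>. Position and letter are separate arguments of
  \<open>F\<close>, because the place of an insertion depends on both.\<close>

lemma sum_rotate_index:
  fixes F :: "nat \<Rightarrow> 'a \<Rightarrow> real"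
  assumes m: "m \<le> length l"
  shows "(\<Sum>k<length l. F k (rotate m l ! k)) = (\<Sum>y<length l. F ((y + length l - m) mod length l) (l ! y))"
proof (rule sum.reindex_bij_witness[where i = "\<lambda>y. (y + length l - m) mod length l" and j = "\<lambda>k. (m + k) mod length l"])
  fix k assume "k \<in> {..<length l}"
  then have k: "k < length l" by simp
  have *: "(m + k) mod length l = (if m + k < length l then m + k else m + k - length l)"
    using k m by (simp add: mod_less_twice)
  show "((m + k) mod length l + length l - m) mod length l = k"
    unfolding * using k m by (simp add: mod_diff_cases)
  then show "F (((m + k) mod length l + length l - m) mod length l) (l ! ((m + k) mod length l)) = F k (rotate m l ! k)"
    using k by (simp add: nth_rotate)
  show "(m + k) mod length l \<in> {..<length l}" using k by (metis lessThan_iff mod_less_divisor not_less_zero zero_less_iff_neq_zero)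
next
  fix y assume "y \<in> {..<length l}"
  then have y: "y < length l" by simp
  then show "(m + (y + length l - m) mod length l) mod length l = y"
    using m by (auto simp: mod_diff_cases)
  show "(y + length l - m) mod length l \<in> {..<length l}"
    using y by (metis lessThan_iff mod_less_divisor not_less_zero zero_less_iff_neq_zero)
qed

text \<open>The segment excludes both ends. For \<open>x = y\<close> it is the whole cycle without
  the letter at \<open>x\<close>, of length \<open>length l - 1\<close>, as used in
  deformations.\<close>

lemma length_cseg: "x < length l \<Longrightarrow> y < length l \<Longrightarrow>
    length (cseg l x y) = (if Suc x \<le> y then y - Suc x else y + length l - Suc x)"
  using mod_diff_cases[of y "length l" "Suc x"] by (simp add: cseg_def)

lemma cseg_eq_take:
  assumes "x < length l" "y < length l"
  shows "cseg l x y = take (length (cseg l x y)) (rotate (Suc x) l)"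
proof (rule nth_equalityI)
  show "length (cseg l x y) = length (take (length (cseg l x y)) (rotate (Suc x) l))"
    using assms by (simp add: length_cseg)
  show "cseg l x y ! i = take (length (cseg l x y)) (rotate (Suc x) l) ! i" if "i < length (cseg l x y)" for i
  proof -
    have "i < length l" using that assms by (auto simp: length_cseg split: if_splits)
    then show ?thesis using that by (simp add: cseg_def nth_rotate del: rotate_Suc)
  qed
qed

lemma rotate_Suc_cseg_self:
  assumes "x < length l"
  shows "rotate (Suc x) l = cseg l x x @ [l ! x]"
proof -
  let ?R = "rotate (Suc x) l"
  have len: "length (cseg l x x) = length l - 1" using assms by (simp add: length_cseg)
  have "?R = take (length l - 1) ?R @ drop (length l - 1) ?R" by simp
  also have "drop (length l - 1) ?R = [?R ! (length l - 1)]"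
    using assms Cons_nth_drop_Suc[of "length l - 1" ?R] by (simp del: rotate_Suc)
  also have "?R ! (length l - 1) = l ! x"
  proof -
    have "Suc x + (length l - 1) = x + length l" using assms by simp
    then show ?thesis using assms by (simp add: nth_rotate del: rotate_Suc add_Suc)
  qed
  also have "take (length l - 1) ?R = cseg l x x"
    using cseg_eq_take[OF assms assms] len by simp
  finally show ?thesis .
qed

text \<open>The cycle read from just after \<open>x\<close>: two marked letters separate two arcs.
  Together with the reading from \<open>x\<close> itself this covers both ways of opening a loop at
  an occurrence.\<close>

lemma rotate_Suc_cseg:
  assumes "x < length l" "y < length l" "x \<noteq> y"
  shows "rotate (Suc x) l = cseg l x y @ [l ! y] @ cseg l y x @ [l ! x]"
proof -
  let ?R = "rotate (Suc x) l" and ?n = "length l"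
  define j where "j = length (cseg l x y)"
  define i where "i = length (cseg l y x)"
  have ij: "i + j + 2 = ?n" using assms by (auto simp: i_def j_def length_cseg)
  have Rj: "?R ! j = l ! y"
    using assms by (auto simp: j_def length_cseg nth_rotate mod_less_twice simp del: rotate_Suc)
  \<comment> \<open>A further rotation by \<open>Suc j\<close> starts just after \<open>y\<close>,
    so the second arc is found as an initial segment, exactly like the first.\<close>
  have Sj: "rotate (Suc j) ?R = rotate (Suc y) l"
  proof -
    have "rotate (Suc j) ?R = rotate ((Suc j + Suc x) mod ?n) l"
      by (metis rotate_conv_mod rotate_rotate)
    also have "(Suc j + Suc x) mod ?n = Suc y mod ?n"
      using assms by (auto simp: j_def length_cseg mod_less_twice)
    finally show ?thesis using rotate_conv_mod by metis
  qed
  have "rotate (Suc y) l = drop (Suc j) ?R @ take (Suc j) ?R"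
    unfolding Sj[symmetric] using ij by (intro rotate_drop_take[THEN trans]) simp
  then have "drop (Suc j) ?R = take (Suc i) (rotate (Suc y) l)"
    using ij by (simp del: rotate_Suc)
  also have "\<dots> = take i (rotate (Suc y) l) @ [rotate (Suc y) l ! i]"
    using ij by (intro take_Suc_conv_app_nth) simp
  also have "rotate (Suc y) l ! i = l ! x"
    using assms by (auto simp: i_def length_cseg nth_rotate mod_less_twice simp del: rotate_Suc)
  also have "take i (rotate (Suc y) l) = cseg l y x"
    using cseg_eq_take[of y l x] assms by (simp add: i_def)
  finally have D: "drop (Suc j) ?R = cseg l y x @ [l ! x]" .
  have "?R = take j ?R @ ?R ! j # drop (Suc j) ?R"
    using ij by (intro id_take_nth_drop) simp
  also have "take j ?R = cseg l x y"
    using cseg_eq_take[of x l y] assms by (simp add: j_def)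
  finally show ?thesis unfolding D Rj by simp
qed

lemma rotate_cseg_self: "x < length l \<Longrightarrow> rotate x l = l ! x # cseg l x x"
proof -
  assume x: "x < length l"
  then have ne: "rotate x l \<noteq> []" by auto
  have "hd (rotate x l) = l ! x" using x ne by (simp add: hd_conv_nth nth_rotate)
  moreover have "rotate1 (rotate x l) = cseg l x x @ [l ! x]" using rotate_Suc_cseg_self[OF x] by simp
  ultimately show ?thesis using ne by (cases "rotate x l") simp_all
qed

lemma rotate_cseg:
  assumes "x < length l" "y < length l" "x \<noteq> y"
  shows "rotate x l = l ! x # cseg l x y @ [l ! y] @ cseg l y x"
proof -
  have ne: "rotate x l \<noteq> []" using assms by auto
  have "hd (rotate x l) = l ! x" using assms ne by (simp add: hd_conv_nth nth_rotate)
  moreover have "rotate1 (rotate x l) = cseg l x y @ [l ! y] @ cseg l y x @ [l ! x]"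
    using rotate_Suc_cseg[OF assms] by simp
  ultimately show ?thesis using ne by (cases "rotate x l") simp_all
qed

lemma walk_rotate: "walk d v l v \<Longrightarrow> \<exists>u. walk d u (rotate k l) u"
proof (induction k)
  case (Suc k)
  then obtain u where "walk d u (rotate k l) u" by blast
  then have "\<exists>u'. walk d u' (rotate1 (rotate k l)) u'"
    by (cases "rotate k l") (auto simp: walk_append)
  then show ?case by simp
qed auto

section \<open>Splittings and deformations produce loops\<close>

lemma set_split1: "x < length l \<Longrightarrow> y < length l \<Longrightarrow> x \<noteq> y \<Longrightarrow> set (split1 l x y) \<subseteq> set l"
  and set_split2: "x < length l \<Longrightarrow> y < length l \<Longrightarrow> x \<noteq> y \<Longrightarrow> set (split2 l x y) \<subseteq> set l"
proof -
  assume *: "x < length l" "y < length l" "x \<noteq> y"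
  have "set l = {l ! x, l ! y} \<union> set (cseg l x y) \<union> set (cseg l y x)"
    using arg_cong[OF rotate_cseg[OF *], of set] by auto
  then show "set (split1 l x y) \<subseteq> set l" "set (split2 l x y) \<subseteq> set l"
    using set_core[of "l ! x # cseg l y x"] set_core[of "cseg l y x"]
      set_core[of "cseg l x y @ [l ! x]"] set_core[of "cseg l x y"]
    by (auto simp: split1_def split2_def)
qed

text \<open>If the two edges agree, each arc closes up after adding one copy of the edge; if they
  are opposite, each arc is already closed. Taking the core then gives a loop or the null
  loop.\<close>

lemma split_loops:
  assumes "is_loop d l" and *: "x < length l" "y < length l" "x \<noteq> y" and "l ! y = l ! x \<or> l ! y = einv (l ! x)"
  shows "(split1 l x y = [] \<or> is_loop d (split1 l x y)) \<and> (split2 l x y = [] \<or> is_loop d (split2 l x y))"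
proof -
  have "walk d (fst (hd l)) l (fst (hd l))"
    using assms(1) by (simp add: is_loop_def closed_path_iff_walk)
  then obtain u where u: "walk d u (l ! x # cseg l x y @ [l ! y] @ cseg l y x) u"
    using walk_rotate[of d _ l x] unfolding rotate_cseg[OF *] by blast
  then have w: "is_edge d (l ! x)" "fst (l ! x) = u" "walk d (snd (l ! x)) (cseg l x y) (fst (l ! y))"
    "walk d (snd (l ! y)) (cseg l y x) u"
    by (auto simp: walk_append)
  show ?thesis
  proof (cases "l ! y = l ! x")
    case True
    have "walk d u (l ! x # cseg l y x) u" "walk d (snd (l ! x)) (cseg l x y @ [l ! x]) (snd (l ! x))"
      using w True by (auto simp: walk_append)
    from this[THEN core_loop] True show ?thesis unfolding split1_def split2_def by simp
  next
    case False
    then have "l ! y = einv (l ! x)" using assms by blast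
    then have "walk d u (cseg l y x) u" "walk d (snd (l ! x)) (cseg l x y) (snd (l ! x))"
      using w by auto
    from this[THEN core_loop] False show ?thesis unfolding split1_def split2_def by simp
  qed
qed

lemma plaq_walk: "p \<in> Pplus d \<Longrightarrow> \<exists>v. walk d v p v"
  by (auto simp: Pplus_def plaq_def is_edge_def einv_def plaq_pos_edges)

text \<open>The four corners are distinct: heights separate the bottom and top corners from the
  middle ones, and coordinate \<open>i\<close> separates the two middle ones. So no undirected edge
  is traversed twice, and merging with a plaquette has a single term.\<close>

lemma plaq_unique:
  assumes p: "p \<in> Pplus d" and k: "k < length p" "k' < length p" and e: "p ! k = e \<or> p ! k = einv e" "p ! k' = e \<or> p ! k' = einv e"
  shows "k' = k"
proof -
  obtain x i j where p': "p = plaq x i j" and x: "x \<in> vtx d" "i < j" "j < d"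
    using p by (auto simp: Pplus_def)
  have ij: "i < length x" "j < length x" "j < length (step x i)"
    using x by (simp_all add: vtx_def step_def)
  have s: "sum_list (step x i) = sum_list x + 1" "sum_list (step x j) = sum_list x + 1"
    "sum_list (step (step x i) j) = sum_list x + 2"
    using sum_list_step[OF ij(1)] sum_list_step[OF ij(2)] sum_list_step[OF ij(3)] by simp_all
  have "step x i ! i \<noteq> step x j ! i" using ij x by (simp add: step_def)
  then have ne: "step x i \<noteq> x" "step x j \<noteq> x" "step (step x i) j \<noteq> x" "step x i \<noteq> step x j"
    "step (step x i) j \<noteq> step x i" "step (step x i) j \<noteq> step x j"
    using s by auto
  have "k \<in> {0,1,2,3}" "k' \<in> {0,1,2,3}" using k by (auto simp: p' plaq_def)
  then show ?thesis
    using e ne ne[symmetric] by (auto simp: p' plaq_def einv_def)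
qed

lemma pidx_props: "f \<in> set p \<Longrightarrow> pidx p f < length p \<and> p ! pidx p f = f"
  unfolding pidx_def by (rule LeastI_ex) (auto simp: in_set_conv_nth)

lemma pidx_split: "f \<in> set p \<Longrightarrow> p = take (pidx p f) p @ f # drop (Suc (pidx p f)) p"
  using pidx_props[of f p] id_take_nth_drop[of "pidx p f" p] by simp

text \<open>Removing \<open>f\<close> from the plaquette leaves \<open>g\<close> followed by
  \<open>c\<close>, a path from the end of \<open>f\<close> back to its start. Its reverse can
  replace \<open>f\<close>, and inserting the path after \<open>f\<close> allows \<open>f\<close> to
  be traversed again; the case of \<open>einv f\<close> is symmetric.\<close>

lemma deform_loops:
  assumes "is_loop d l" and x: "x < length l" and p: "p \<in> Pplus d" "l ! x \<in> set p \<or> einv (l ! x) \<in> set p"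
  shows "(dplus l x p = [] \<or> is_loop d (dplus l x p)) \<and> (dminus l x p = [] \<or> is_loop d (dminus l x p))"
proof -
  define f where "f = l ! x"
  define r where "r = cseg l x x"
  obtain v where v: "walk d v p v" using plaq_walk[OF p(1)] by blast
  have "walk d (fst (hd l)) l (fst (hd l))"
    using assms(1) by (simp add: is_loop_def closed_path_iff_walk)
  then obtain u where u: "walk d u (f # r) u"
    using walk_rotate[of d _ l x] unfolding rotate_cseg_self[OF x] f_def r_def by blast
  then have f: "is_edge d f" "fst f = u" "walk d (snd f) r u" by auto
  show ?thesis
  proof (cases "f \<in> set p")
    case True
    define c where "c = take (pidx p f) p"
    define g where "g = drop (Suc (pidx p f)) p"
    have "walk d v (c @ f # g) v" using v pidx_split[OF True] by (simp add: c_def g_def)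
    then have cg: "walk d v c u" "walk d (snd f) g v" using f by (auto simp: walk_append)
    have "walk d u (f # g @ c @ f # r) u"
      using cg f by (auto simp: walk_append)
    moreover have "walk d u (pinv c @ pinv g @ r) u"
      using walk_pinv[OF cg(1)] walk_pinv[OF cg(2)] f by (auto simp: walk_append)
    ultimately show ?thesis
      using True core_loop[of d u] unfolding dplus_def dminus_def Let_def f_def[symmetric] r_def[symmetric] c_def[symmetric] g_def[symmetric] by simp
  next
    case False
    define c where "c = take (pidx p (einv f)) p"
    define g where "g = drop (Suc (pidx p (einv f))) p"
    have "einv f \<in> set p" using p False by (simp add: f_def)
    then have "walk d v (c @ einv f # g) v" using v pidx_split[of "einv f" p] by (simp add: c_def g_def)
    then have cg: "walk d v c (snd f)" "walk d u g v" using f by (auto simp: walk_append)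
    have "walk d u (f # pinv c @ pinv g @ f # r) u"
      using walk_pinv[OF cg(1)] walk_pinv[OF cg(2)] f by (auto simp: walk_append)
    moreover have "walk d u (g @ c @ r) u"
      using cg f by (auto simp: walk_append)
    ultimately show ?thesis
      using False core_loop[of d u] unfolding dplus_def dminus_def Let_def f_def[symmetric] r_def[symmetric] c_def[symmetric] g_def[symmetric] by simp
  qed
qed

lemma set_deform:
  assumes "x < length l"
  shows "set (dplus l x p) \<subseteq> set l \<union> set p \<union> einv ` set p" "set (dminus l x p) \<subseteq> set l \<union> set p \<union> einv ` set p"
proof -
  have l: "set l = insert (l ! x) (set (cseg l x x))"
    using arg_cong[OF rotate_cseg_self[OF assms], of set] by simp
  have [simp]: "einv f \<in> einv ` set p \<longleftrightarrow> f \<in> set p" for f by auto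
  show "set (dplus l x p) \<subseteq> set l \<union> set p \<union> einv ` set p"
    unfolding dplus_def Let_def l
    by (auto split: if_splits dest!: set_core[THEN subsetD] dest!: in_set_takeD in_set_dropD)
  show "set (dminus l x p) \<subseteq> set l \<union> set p \<union> einv ` set p"
    unfolding dminus_def Let_def l
    by (auto split: if_splits dest!: set_core[THEN subsetD] dest!: in_set_takeD in_set_dropD)
qed

subsection \<open>The loop equation at finite \<open>N\<close>\<close>

lemma sg_simps [simp]: "sg e e = 1" "is_edge d e \<Longrightarrow> sg e (einv e) = -1"
  by (auto simp: sg_def dest: einv_neq)

lemma W_cancel:
  assumes "is_edge d f" "orth N (Qof d Q f)"
  shows "W d N Q (u @ f # einv f # v) = W d N Q (u @ v)" "W d N Q (u @ einv f # f # v) = W d N Q (u @ v)"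
  unfolding W_def hol_append hol_einv_cancel[OF assms] by simp_all

lemma W_cancel_ends:
  assumes "is_edge d f" "orth N (Qof d Q f)"
  shows "W d N Q (f # v @ [einv f]) = W d N Q v" "W d N Q (einv f # v @ [f]) = W d N Q v"
  using W_cancel[OF assms, of "[]" v] W_commute[of d N Q "f # v" "[einv f]"]
    W_commute[of d N Q "einv f # v" "[f]"] by simp_all

lemma W_pinv: "orth_on d N Q l \<Longrightarrow> W d N Q (pinv l) = W d N Q l"
  unfolding W_def by (subst hol_pinv) (auto simp: orth_on_def)

text \<open>Opens the cycle \<open>l\<close> at the insertion place of the location \<open>x\<close>, so that \<open>e\<close> comes first or
  \<open>einv e\<close> comes last.\<close>

definition base :: "edge \<Rightarrow> edge list \<Rightarrow> nat \<Rightarrow> edge list" where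
  "base e l x = (if l ! x = e then rotate x l else rotate (Suc x) l)"

lemma set_base [simp]: "set (base e l x) = set l" and length_base [simp]: "length (base e l x) = length l"
  by (simp_all add: base_def)

lemma orth_on_base: "orth_on d N Q l \<Longrightarrow> orth_on d N Q (base e l x)"
  by (simp add: orth_on_def)

text \<open>Multiplying by the sign of the chosen occurrence gives the other occurrences the
  coefficient \<open>sg e (l ! x) * sg e (l ! y)\<close>, the sign pattern of the splitting term.
  The error collects the single traces, at most one of size \<open>N\<close> per remaining
  occurrence.\<close>

lemma twist_base:
  assumes l: "orth_on d N Q l" and e: "is_edge d e" and x: "x < length l" "l ! x = e \<or> l ! x = einv e"
  defines "C \<equiv> {y. y < length l \<and> (l ! y = e \<or> l ! y = einv e)}"
  shows "\<bar>sg e (l ! x) * twist d N e Q (base e l x) + (real N - 1) * W d N Q l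
     + (\<Sum>y\<in>C - {x}. sg e (l ! x) * sg e (l ! y) * (W d N Q (split1 l x y) * W d N Q (split2 l x y)))\<bar>
     \<le> real (length l) * real N"
proof -
  define n where "n = length l"
  define m where "m = (if l ! x = e then x else Suc x)"
  define w where "w = rotate m l"
  define b where "b k f = (if f = e then k else Suc k)" for k f
  define F where "F k f = sg e f * (W d N Q (pinv (take (b k f) w) @ drop (b k f) w)
      - W d N Q (take (b k f) w) * W d N Q (drop (b k f) w))" for k f
  define idx where "idx y = (y + n - m) mod n" for y
  let ?W = "W d N Q"
  have ne: "einv e \<noteq> e" using einv_neq[OF e] .
  have mn: "m \<le> n" using x by (simp add: m_def n_def)
  have w: "base e l x = w" by (simp add: base_def w_def m_def)
  have ow: "orth_on d N Q w" using orth_on_base[OF l, of e x] w by simp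
  have Ww: "?W w = ?W l" by (simp add: w_def)
  have ot: "orth_on d N Q (take k w)" "orth_on d N Q (drop k w)" for k
    using orth_on_subset[OF ow] by (simp_all add: set_take_subset set_drop_subset)
  have ox: "orth N (Qof d Q (l ! x))" "is_edge d (l ! x)"
    using l x(1) by (auto simp: orth_on_def)
  have oe: "orth N (Qof d Q e)"
    using ox x(2) e by (auto simp: Qof_einv dest: orth_mtrans)
  have "twist d N e Q w = (\<Sum>k<n. F k (w ! k))"
    by (simp add: twist_def F_def b_def brk_def w_def n_def)
  also have "\<dots> = (\<Sum>y<n. F (idx y) (l ! y))"
    unfolding w_def n_def idx_def by (rule sum_rotate_index) (use mn n_def in simp)
  also have "\<dots> = (\<Sum>y\<in>C. F (idx y) (l ! y))"
    by (rule sum.mono_neutral_right) (auto simp: C_def n_def F_def sg_def)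
  also have "\<dots> = F (idx x) (l ! x) + (\<Sum>y\<in>C - {x}. F (idx y) (l ! y))"
    using x by (intro sum.remove) (auto simp: C_def)
  finally have tw: "twist d N e Q w = F (idx x) (l ! x) + (\<Sum>y\<in>C - {x}. F (idx y) (l ! y))" .
  \<comment> \<open>The base is chosen so that the insertion for the occurrence \<open>x\<close>
    falls at an end of the word. One of the two parts is then empty with trace \<open>N\<close>, and
    the reversed full word has the same trace as \<open>l\<close>.\<close>
  have Fx: "sg e (l ! x) * F (idx x) (l ! x) = - (real N - 1) * ?W l"
  proof (cases "l ! x = e")
    case True
    then have "idx x = 0" using x by (simp add: idx_def m_def n_def)
    then show ?thesis using True by (simp add: F_def b_def Ww algebra_simps)
  next
    case False
    then have "Suc (idx x) = length w"
      using x by (simp add: idx_def m_def n_def w_def mod_less_twice)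
    then show ?thesis using False x e ne
      by (simp add: F_def b_def Ww W_pinv[OF ow] algebra_simps)
  qed
  have Fy: "\<bar>sg e (l ! x) * F (idx y) (l ! y) + sg e (l ! x) * sg e (l ! y) * (?W (split1 l x y) * ?W (split2 l x y))\<bar> \<le> real N"
    if y: "y \<in> C - {x}" for y
  proof -
    have yn: "y < length l" "x \<noteq> y" and ye: "l ! y = e \<or> l ! y = einv e" using y by (auto simp: C_def)
    define s where "s = cseg l x y"
    define t where "t = cseg l y x"
    define k where "k = b (idx y) (l ! y)"
    have idx: "idx y = (if l ! x = e then Suc (length s) else length s)"
      using yn x by (auto simp: idx_def m_def n_def s_def length_cseg mod_less_twice)
    have weq: "w = (if l ! x = e then e # s @ [l ! y] @ t else s @ [l ! y] @ t @ [l ! x])"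
      using rotate_cseg[OF x(1) yn] rotate_Suc_cseg[OF x(1) yn]
      by (auto simp: w_def m_def s_def t_def simp del: rotate_Suc)
    have st: "orth_on d N Q s" "orth_on d N Q t"
      using ow unfolding weq by (auto split: if_splits)
    have sp: "?W (split1 l x y) = (if l ! y = l ! x then ?W (l ! x # t) else ?W t)"
      "?W (split2 l x y) = (if l ! y = l ! x then ?W (s @ [l ! x]) else ?W s)"
      using st ox by (simp_all add: split1_def split2_def W_core s_def t_def)
    \<comment> \<open>For equal orientations each part is an arc with one copy of the edge, up to
      rotation. For opposite ones both copies fall into the same part, at its two ends, and cancel
      cyclically.\<close>
    have "?W (take k w) * ?W (drop k w) = ?W (split1 l x y) * ?W (split2 l x y)"
    proof (cases "l ! x = e"; cases "l ! y = e")
      assume *: "l ! x = e" "l ! y = e"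
      then have "take k w = e # s" "drop k w = e # t" using weq idx by (simp_all add: k_def b_def)
      then show ?thesis using sp * W_commute[of d N Q "[e]" s] by simp
    next
      assume *: "l ! x = e" "l ! y \<noteq> e"
      then have "take k w = e # s @ [einv e]" "drop k w = t" using weq idx ye by (simp_all add: k_def b_def)
      then show ?thesis using sp * W_cancel_ends(1)[OF e oe, of s] by simp
    next
      assume *: "l ! x \<noteq> e" "l ! y = e"
      then have "take k w = s" "drop k w = e # t @ [einv e]" using weq idx x(2) by (simp_all add: k_def b_def)
      then show ?thesis using sp * W_cancel_ends(1)[OF e oe, of t] by simp
    next
      assume *: "l ! x \<noteq> e" "l ! y \<noteq> e"
      then have "l ! x = einv e" "l ! y = einv e" using x(2) ye by auto
      then have "take k w = s @ [einv e]" "drop k w = t @ [einv e]" using weq idx ne by (simp_all add: k_def b_def)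
      then show ?thesis using sp \<open>l ! x = einv e\<close> \<open>l ! y = einv e\<close> W_commute[of d N Q "[einv e]" t] by simp
    qed
    then have "sg e (l ! x) * F (idx y) (l ! y) + sg e (l ! x) * sg e (l ! y) * (?W (split1 l x y) * ?W (split2 l x y))
      = sg e (l ! x) * sg e (l ! y) * ?W (pinv (take k w) @ drop k w)"
      by (simp add: F_def k_def algebra_simps)
    moreover have "\<bar>?W (pinv (take k w) @ drop k w)\<bar> \<le> real N"
      using ot orth_on_pinv by (intro W_le) simp
    ultimately show ?thesis by (simp add: sg_def abs_mult)
  qed
  have "sg e (l ! x) * twist d N e Q (base e l x) + (real N - 1) * W d N Q l
     + (\<Sum>y\<in>C - {x}. sg e (l ! x) * sg e (l ! y) * (?W (split1 l x y) * ?W (split2 l x y)))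
    = (\<Sum>y\<in>C - {x}. sg e (l ! x) * F (idx y) (l ! y) + sg e (l ! x) * sg e (l ! y) * (?W (split1 l x y) * ?W (split2 l x y)))"
    unfolding w tw distrib_left Fx sum.distrib sum_distrib_left by (simp add: left_diff_distrib)
  also have "\<bar>\<dots>\<bar> \<le> (\<Sum>y\<in>C - {x}. real N)"
    by (rule order_trans[OF sum_abs sum_mono[OF Fy]])
  also have "\<dots> = real (card (C - {x})) * real N" by simp
  also have "\<dots> \<le> real (length l) * real N"
    using card_mono[of "{..<length l}" "C - {x}"] by (intro mult_right_mono) (auto simp: C_def)
  finally show ?thesis .
qed

lemma merging_le:
  assumes "orth_on d N Q w" "orth_on d N Q v"
  shows "\<bar>merging d N e Q w v\<bar> \<le> 2 * real (length v) * real N"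
proof -
  let ?V = "\<lambda>k. drop (brk e v k) v @ take (brk e v k) v"
  have "\<bar>merging d N e Q w v\<bar> \<le> (\<Sum>k<length v. 2 * real N)"
    unfolding merging_def
  proof (rule order_trans[OF sum_abs sum_mono])
    fix k
    have V: "orth_on d N Q (?V k)"
      using assms(2) by (rule orth_on_subset) (auto dest: in_set_takeD in_set_dropD)
    have "\<bar>W d N Q (w @ pinv (?V k))\<bar> \<le> real N" "\<bar>W d N Q (w @ ?V k)\<bar> \<le> real N"
      using assms(1) V orth_on_pinv[OF V] by (auto intro!: W_le)
    then have "\<bar>W d N Q (w @ pinv (?V k)) - W d N Q (w @ ?V k)\<bar> \<le> 2 * real N" by linarith
    then show "\<bar>sg e (v ! k) * (W d N Q (w @ pinv (?V k)) - W d N Q (w @ ?V k))\<bar> \<le> 2 * real N"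
      by (auto simp: sg_def abs_minus_commute)
  qed
  then show ?thesis by simp
qed

lemma merging_zero: "e \<notin> set p \<Longrightarrow> einv e \<notin> set p \<Longrightarrow> merging d N e Q w p = 0"
  unfolding merging_def by (rule sum.neutral) (auto simp: sg_def dest: nth_mem)

text \<open>An exact identity without error. Whichever glueing places the edge next to its inverse
  loses that pair and is \<open>dminus\<close>; the other is \<open>dplus\<close>. If the plaquette
  carries the opposite orientation, the two glueings exchange roles and the sign of the occurrence
  compensates.\<close>

lemma merging_plaq:
  assumes p: "p \<in> Pplus d" "e \<in> set p \<or> einv e \<in> set p" and op: "orth_on d N Q p"
    and l: "orth_on d N Q l" and e: "is_edge d e" and x: "x < length l" "l ! x = e \<or> l ! x = einv e"
  shows "sg e (l ! x) * merging d N e Q (base e l x) p = W d N Q (dminus l x p) - W d N Q (dplus l x p)"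
proof -
  let ?W = "W d N Q"
  have ne: "einv e \<noteq> e" using einv_neq[OF e] .
  have single: "merging d N e Q w p = sg e (p ! k) *
     (?W (w @ pinv (drop (brk e p k) p @ take (brk e p k) p)) - ?W (w @ drop (brk e p k) p @ take (brk e p k) p))"
    if k: "k < length p" "p ! k = e \<or> p ! k = einv e" for k w
  proof -
    have "sg e (p ! j) = 0" if "j < length p" "j \<noteq> k" for j
      using plaq_unique[OF p(1) k(1) that(1) k(2)] that(2) by (auto simp: sg_def)
    then show ?thesis
      unfolding merging_def by (subst sum.remove[of _ k]) (use k in auto)
  qed
  define f where "f = l ! x"
  define r where "r = cseg l x x"
  have fr: "orth_on d N Q (f # r)"
    using orth_on_base[OF l, of f x] x rotate_cseg_self[OF x(1)] by (simp add: base_def f_def r_def)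
  have fe: "f = e \<or> f = einv e" using x f_def by simp
  have base: "base e l x = (if f = e then f # r else r @ [f])"
    using rotate_cseg_self[OF x(1)] rotate_Suc_cseg_self[OF x(1)] by (simp add: base_def f_def r_def)
  have if': "is_edge d f" "orth N (Qof d Q f)" "orth_on d N Q r" using fr by auto
  note [simp] = this
  show ?thesis
  proof (cases "f \<in> set p")
    case True
    define k where "k = pidx p f"
    define c where "c = take k p"
    define g where "g = drop (Suc k) p"
    have k: "k < length p" "p ! k = f" using pidx_props[OF True] by (simp_all add: k_def)
    have pp: "p = c @ f # g" using pidx_split[OF True] by (simp add: c_def g_def k_def)
    have dk: "drop k p = f # g" using pp k c_def by (metis Cons_nth_drop_Suc g_def)
    have tk: "take (Suc k) p = c @ [f]" using k by (simp add: take_Suc_conv_app_nth c_def)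
    have ocg [simp]: "orth_on d N Q c" "orth_on d N Q g" using op unfolding pp by auto
    have d: "?W (dplus l x p) = ?W (f # g @ c @ f # r)" "?W (dminus l x p) = ?W (pinv c @ pinv g @ r)"
      using True by (simp_all add: dplus_def dminus_def Let_def W_core orth_on_pinv
          flip: f_def r_def k_def c_def g_def)
    show ?thesis
    proof (cases "f = e")
      case fe: True
      have "merging d N e Q (base e l x) p = ?W (f # r @ pinv (f # g @ c)) - ?W (f # r @ f # g @ c)"
        using single[of k "base e l x"] k fe dk base by (simp add: brk_def flip: c_def)
      also have "?W (f # r @ pinv (f # g @ c)) = ?W (r @ pinv c @ pinv g)"
        using W_cancel_ends(1)[OF if'(1,2), of "r @ pinv c @ pinv g"] by (simp add: pinv_Cons)
      finally show ?thesis
        using fe d W_commute[of d N Q r "pinv c @ pinv g"] W_commute[of d N Q "f # r" "f # g @ c"]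
        by (simp flip: f_def)
    next
      case False
      with fe have fe': "f = einv e" by blast
      have "merging d N e Q (base e l x) p = - (?W (r @ f # pinv (g @ c @ [f])) - ?W (r @ f # g @ c @ [f]))"
        using single[of k "base e l x"] k fe' ne tk base e by (simp add: brk_def flip: g_def)
      also have "?W (r @ f # pinv (g @ c @ [f])) = ?W (r @ pinv c @ pinv g)"
        using W_cancel(1)[OF if'(1,2), of r "pinv c @ pinv g"] by (simp add: pinv_Cons)
      finally show ?thesis
        using fe' e d W_commute[of d N Q r "pinv c @ pinv g"] W_commute[of d N Q r "f # g @ c @ [f]"]
        by (simp flip: f_def)
    qed
  next
    case False
    have fp: "einv f \<in> set p" using False p(2) fe by auto
    define k where "k = pidx p (einv f)"
    define c where "c = take k p"
    define g where "g = drop (Suc k) p"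
    have k: "k < length p" "p ! k = einv f" using pidx_props[OF fp] by (simp_all add: k_def)
    have pp: "p = c @ einv f # g" using pidx_split[OF fp] by (simp add: c_def g_def k_def)
    have dk: "drop k p = einv f # g" using pp k c_def by (metis Cons_nth_drop_Suc g_def)
    have tk: "take (Suc k) p = c @ [einv f]" using k by (simp add: take_Suc_conv_app_nth c_def)
    have ocg [simp]: "orth_on d N Q c" "orth_on d N Q g" using op unfolding pp by auto
    have d: "?W (dplus l x p) = ?W (f # pinv c @ pinv g @ f # r)" "?W (dminus l x p) = ?W (g @ c @ r)"
      using False by (simp_all add: dplus_def dminus_def Let_def W_core orth_on_pinv
          flip: f_def r_def k_def c_def g_def)
    show ?thesis
    proof (cases "f = e")
      case fe: True
      have "merging d N e Q (base e l x) p = - (?W (f # r @ pinv (g @ c @ [einv f])) - ?W (f # r @ g @ c @ [einv f]))"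
        using single[of k "base e l x"] k fe ne tk base e by (simp add: brk_def flip: g_def)
      also have "?W (f # r @ g @ c @ [einv f]) = ?W (r @ g @ c)"
        using W_cancel_ends(1)[OF if'(1,2), of "r @ g @ c"] by simp
      finally show ?thesis
        using fe d W_commute[of d N Q r "g @ c"] W_commute[of d N Q "f # r" "f # pinv c @ pinv g"]
        by (simp add: pinv_Cons flip: f_def)
    next
      case False
      with fe have fe': "f = einv e" by blast
      have "merging d N e Q (base e l x) p = ?W (r @ f # pinv (einv f # g @ c)) - ?W (r @ f # einv f # g @ c)"
        using single[of k "base e l x"] k fe' ne dk base e by (simp add: brk_def flip: c_def)
      also have "?W (r @ f # einv f # g @ c) = ?W (r @ g @ c)"
        using W_cancel(1)[OF if'(1,2), of r "g @ c"] by simp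
      finally show ?thesis
        using fe' e d W_commute[of d N Q r "g @ c"] W_commute[of d N Q r "f # pinv c @ pinv g @ [f]"]
        by (simp add: pinv_Cons flip: f_def)
    qed
  qed
qed

section \<open>The normalised equation with an explicit error\<close>

context lattice_gauge
begin

abbreviation "\<phi>N \<equiv> phi_fin d L N \<beta> \<sigma>"

lemma supported_base: "supported l \<Longrightarrow> supported (base e l x)"
  by (simp add: supported_def)

lemma nice_twist: "supported w \<Longrightarrow> nice (\<lambda>Q. twist d N e Q w)"
  unfolding twist_def
  by (intro nice_sum nice_mult nice_const nice_diff nice_W) auto

lemma nice_merging: "supported w \<Longrightarrow> supported v \<Longrightarrow> nice (\<lambda>Q. merging d N e Q w v)"
  unfolding merging_def
  by (intro nice_sum nice_mult nice_const nice_diff nice_W) auto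

lemma EV_diff: "nice F \<Longrightarrow> nice G \<Longrightarrow> EV (\<lambda>Q. F Q - G Q) = EV F - EV G"
  using EV_add[of F "\<lambda>Q. (-1) * G Q"] nice_mult[OF nice_const[of "-1"], of G] EV_cmult[of "-1" G] by simp

lemma EV_W_prod:
  assumes "N > 0"
  shows "EV (\<lambda>Q. W d N Q u * (\<Prod>i<length ls. W d N Q (ls ! i))) = real N ^ (length ls + 1) * \<phi>N (u # ls)"
  using assms by (simp add: phi_fin_def prod.lessThan_Suc_shift del: prod.lessThan_Suc)

lemma EV_W_W_prod:
  assumes "N > 0"
  shows "EV (\<lambda>Q. W d N Q u * W d N Q v * (\<Prod>i<length ls. W d N Q (ls ! i)))
    = real N ^ (length ls + 2) * \<phi>N (u # v # ls)"
  using assms by (simp add: phi_fin_def prod.lessThan_Suc_shift mult.assoc del: prod.lessThan_Suc)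

lemma prod_W_le:
  assumes "conf Q" "\<And>i. i \<in> I \<Longrightarrow> supported (v i)" "card I = n" "N > 0"
  shows "\<bar>\<Prod>i\<in>I. W d N Q (v i)\<bar> \<le> real N ^ n"
proof -
  have "(\<Prod>i\<in>I. \<bar>W d N Q (v i)\<bar>) \<le> (\<Prod>i\<in>I. real N)"
    using assms by (intro prod_mono conjI W_le orth_on_conf) auto
  then show ?thesis using assms by (simp add: abs_prod)
qed

text \<open>All plaquettes at \<open>e\<close> must lie in the region, for otherwise the weight
  would not produce every deformation. The constant adds \<open>length l\<close> from the twistings
  to twice the length of each other loop from the mergings.\<close>

lemma loop_equation_finite:
  assumes N: "N > 0" and e: "e \<in> E" and l: "supported l" and ls: "\<And>i. i < length ls \<Longrightarrow> supported (ls ! i)"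
    and x: "x < length l" "l ! x = e \<or> l ! x = einv e" and P: "Pplus_e d e \<subseteq> Pplus_L d L"
  defines "C \<equiv> {y. y < length l \<and> (l ! y = e \<or> l ! y = einv e)}"
  shows "\<bar>(1 - 1 / real N) * \<phi>N (l # ls)
      + (\<Sum>y\<in>C - {x}. sg e (l ! x) * sg e (l ! y) * \<phi>N (split1 l x y # split2 l x y # ls))
      - \<beta> * (\<Sum>p\<in>Pplus_e d e. \<phi>N (dminus l x p # ls) - \<phi>N (dplus l x p # ls))\<bar>
     \<le> (real (length l) + 2 * (\<Sum>i<length ls. real (length (ls ! i)))) / real N"
proof -
  let ?n = "length ls" and ?W = "W d N"
  let ?K = "real (length l) + 2 * (\<Sum>i<?n. real (length (ls ! i)))"
  define s where "s = sg e (l ! x)"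
  define w where "w = base e l x"
  define R where "R Q = (\<Prod>i<?n. ?W Q (ls ! i))" for Q
  define R' where "R' i Q = (\<Prod>j\<in>{..<?n} - {i}. ?W Q (ls ! j))" for i Q
  define X where "X Q = s * (twist d N e Q w * R Q + (\<Sum>i<?n. merging d N e Q w (ls ! i) * R' i Q)
      + real N * \<beta> * (\<Sum>p\<in>Pplus_L d L. merging d N e Q w p) * R Q)" for Q
  define c where "c y = s * sg e (l ! y)" for y
  define Z where "Z = (1 - 1 / real N) * \<phi>N (l # ls)
      + (\<Sum>y\<in>C - {x}. c y * \<phi>N (split1 l x y # split2 l x y # ls))
      - \<beta> * (\<Sum>p\<in>Pplus_e d e. \<phi>N (dminus l x p # ls) - \<phi>N (dplus l x p # ls))"
  \<comment> \<open>The terms of leading order in \<open>X\<close>, with splittings and deformations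
    in their final form. \<open>X\<close> has expectation zero, so \<open>A\<close> has expectation
    of the size of their difference.\<close>
  define A where "A Q = (- (real N - 1)) * (?W Q l * R Q)
      - (\<Sum>y\<in>C - {x}. c y * (?W Q (split1 l x y) * ?W Q (split2 l x y) * R Q))
      + real N * \<beta> * (\<Sum>p\<in>Pplus_e d e. ?W Q (dminus l x p) * R Q - ?W Q (dplus l x p) * R Q)" for Q
  have ed: "is_edge d e" using E_pos[OF e] by (simp add: is_edge_def)
  have w: "supported w" using l by (simp add: w_def supported_base)
  have abs_s: "\<bar>s\<bar> \<le> 1" by (simp add: s_def sg_def)
  have sp: "supported (split1 l x y)" "supported (split2 l x y)" if "y \<in> C - {x}" for y
    using that x l set_split1[of x l y] set_split2[of x l y] by (auto simp: C_def intro: supported_subset)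
  have pl: "p \<in> Pplus d" "e \<in> set p \<or> einv e \<in> set p" "supported p" if "p \<in> Pplus_e d e" for p
    using that P supported_Pplus_L by (auto simp: Pplus_e_def)
  have df: "supported (dminus l x p)" "supported (dplus l x p)" if "p \<in> Pplus_e d e" for p
  proof -
    have "supported (l @ p @ pinv p)" using l pl(3)[OF that] by simp
    then show "supported (dminus l x p)" "supported (dplus l x p)"
      using set_deform[OF x(1), of p] by (auto simp del: supported_simps intro!: supported_subset[of "l @ p @ pinv p"])
  qed
  have nR: "nice R" "nice (R' i)" for i
    unfolding R_def R'_def using ls by (auto intro!: nice_prod nice_W)
  have nX: "nice X"
    unfolding X_def using w ls nR supported_Pplus_L
    by (intro nice_mult nice_const nice_add nice_twist nice_sum nice_merging) auto
  have nWR: "nice (\<lambda>Q. ?W Q u * R Q)" if "supported u" for u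
    using that nR by (intro nice_mult nice_W)
  have nWWR: "nice (\<lambda>Q. ?W Q u * ?W Q v * R Q)" if "supported u" "supported v" for u v
    using that nR by (intro nice_mult nice_W)
  have nA: "nice A"
    unfolding A_def using l sp df
    by (intro nice_add nice_diff nice_mult[OF nice_const] nice_sum nWR nWWR) auto
  have "(\<integral>Q. X Q * g Q \<partial>M) = (\<integral>Q. s * ((twist d N e Q w * R Q + (\<Sum>i<?n. merging d N e Q w (ls ! i) * R' i Q)
      + real N * \<beta> * (\<Sum>p\<in>Pplus_L d L. merging d N e Q w p) * R Q) * g Q) \<partial>M)"
    by (simp only: X_def mult.assoc)
  also have "\<dots> = 0"
    using schwinger_dyson[OF e w ls, of "?n"] by (simp add: R_def R'_def)
  finally have X0: "EV X = 0" by (simp add: lgt_expect_def)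
  have diff: "\<bar>A Q - X Q\<bar> \<le> ?K * real N ^ (?n + 1)" if Q: "conf Q" for Q
  proof -
    have ol: "orth_on d N Q l" and ow: "orth_on d N Q w"
      using orth_on_conf[OF Q] l w by auto
    define t where "t = s * twist d N e Q w + (real N - 1) * ?W Q l
      + (\<Sum>y\<in>C - {x}. c y * (?W Q (split1 l x y) * ?W Q (split2 l x y)))"
    have t: "\<bar>t\<bar> \<le> real (length l) * real N"
      unfolding t_def c_def s_def w_def C_def by (rule twist_base[OF ol ed x])
    have RN: "\<bar>R Q\<bar> \<le> real N ^ ?n"
      unfolding R_def by (rule prod_W_le[OF Q _ _ N]) (use ls in auto)
    have mg: "s * (\<Sum>p\<in>Pplus_L d L. merging d N e Q w p)
        = (\<Sum>p\<in>Pplus_e d e. ?W Q (dminus l x p) - ?W Q (dplus l x p))"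
    proof -
      have "(\<Sum>p\<in>Pplus_L d L. merging d N e Q w p) = (\<Sum>p\<in>Pplus_e d e. merging d N e Q w p)"
        by (rule sum.mono_neutral_right[OF finite_Pplus_L P])
          (auto simp: Pplus_e_def Pplus_L_def intro!: merging_zero)
      also have "s * \<dots> = (\<Sum>p\<in>Pplus_e d e. ?W Q (dminus l x p) - ?W Q (dplus l x p))"
        unfolding sum_distrib_left
      proof (rule sum.cong[OF refl])
        fix p assume p: "p \<in> Pplus_e d e"
        show "s * merging d N e Q w p = ?W Q (dminus l x p) - ?W Q (dplus l x p)"
          unfolding s_def w_def
          by (rule merging_plaq[OF pl(1,2)[OF p] orth_on_conf[OF Q pl(3)[OF p]] ol ed x])
      qed
      finally show ?thesis .
    qed
    have "X Q - A Q = t * R Q + s * (\<Sum>i<?n. merging d N e Q w (ls ! i) * R' i Q)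
       + real N * \<beta> * R Q * (s * (\<Sum>p\<in>Pplus_L d L. merging d N e Q w p)
         - (\<Sum>p\<in>Pplus_e d e. ?W Q (dminus l x p) - ?W Q (dplus l x p)))"
      unfolding X_def A_def t_def left_diff_distrib[symmetric] sum_distrib_right[symmetric]
        mult.assoc[symmetric] by (simp add: algebra_simps)
    also have "\<dots> = t * R Q + s * (\<Sum>i<?n. merging d N e Q w (ls ! i) * R' i Q)"
      unfolding mg by simp
    finally have XA: "X Q - A Q = t * R Q + s * (\<Sum>i<?n. merging d N e Q w (ls ! i) * R' i Q)" .
    have "\<bar>t * R Q\<bar> \<le> real (length l) * real N * real N ^ ?n"
      unfolding abs_mult by (intro mult_mono t RN) auto
    moreover have "\<bar>\<Sum>i<?n. merging d N e Q w (ls ! i) * R' i Q\<bar> \<le> (\<Sum>i<?n. 2 * real (length (ls ! i)) * real N ^ ?n)"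
    proof (rule order_trans[OF sum_abs sum_mono])
      fix i assume i: "i \<in> {..<?n}"
      then have "\<bar>R' i Q\<bar> \<le> real N ^ (?n - 1)"
        unfolding R'_def by (intro prod_W_le[OF Q _ _ N]) (use ls in auto)
      moreover have "\<bar>merging d N e Q w (ls ! i)\<bar> \<le> 2 * real (length (ls ! i)) * real N"
        using i ls by (intro merging_le ow orth_on_conf[OF Q]) auto
      ultimately have "\<bar>merging d N e Q w (ls ! i) * R' i Q\<bar> \<le> 2 * real (length (ls ! i)) * real N * real N ^ (?n - 1)"
        unfolding abs_mult by (intro mult_mono) auto
      \<comment> \<open>An index \<open>i\<close> below \<open>?n\<close> exists, so
        \<open>?n - 1\<close> is a true predecessor: merging replaces two traces by one.\<close>
      also have "\<dots> = 2 * real (length (ls ! i)) * real N ^ ?n"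
        using i by (cases ?n) auto
      finally show "\<bar>merging d N e Q w (ls ! i) * R' i Q\<bar> \<le> 2 * real (length (ls ! i)) * real N ^ ?n" .
    qed
    then have "\<bar>s * (\<Sum>i<?n. merging d N e Q w (ls ! i) * R' i Q)\<bar> \<le> 1 * (\<Sum>i<?n. 2 * real (length (ls ! i)) * real N ^ ?n)"
      unfolding abs_mult[of s] by (intro mult_mono abs_s) auto
    \<comment> \<open>Mergings are smaller than the twistings by a power of \<open>N\<close>; this
      is given away so that a single constant covers both.\<close>
    moreover have "(\<Sum>i<?n. 2 * real (length (ls ! i)) * real N ^ ?n) \<le> (\<Sum>i<?n. 2 * real (length (ls ! i)) * real N ^ (?n + 1))"
      using N by (intro sum_mono mult_left_mono power_increasing) auto
    ultimately have "\<bar>X Q - A Q\<bar> \<le> real (length l) * real N * real N ^ ?n + (\<Sum>i<?n. 2 * real (length (ls ! i)) * real N ^ (?n + 1))"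
      unfolding XA by linarith
    also have "\<dots> = ?K * real N ^ (?n + 1)"
      by (simp add: distrib_right sum_distrib_left sum_distrib_right mult.assoc)
    finally show ?thesis by (simp add: abs_minus_commute)
  qed
  have bound: "\<bar>EV A\<bar> \<le> ?K * real N ^ (?n + 1)"
    using EV_abs_le[OF nice_diff[OF nA nX] diff] EV_diff[OF nA nX] X0 by simp
  have "EV A = (- (real N - 1)) * (real N ^ (?n + 1) * \<phi>N (l # ls))
      - (\<Sum>y\<in>C - {x}. c y * (real N ^ (?n + 2) * \<phi>N (split1 l x y # split2 l x y # ls)))
      + real N * \<beta> * (\<Sum>p\<in>Pplus_e d e. real N ^ (?n + 1) * \<phi>N (dminus l x p # ls) - real N ^ (?n + 1) * \<phi>N (dplus l x p # ls))"
  proof -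
    have EVW: "EV (\<lambda>Q. ?W Q u * R Q) = real N ^ (?n + 1) * \<phi>N (u # ls)"
      and EVWW: "EV (\<lambda>Q. ?W Q u * ?W Q v * R Q) = real N ^ (?n + 2) * \<phi>N (u # v # ls)" for u v
      unfolding R_def by (rule EV_W_prod[OF N], rule EV_W_W_prod[OF N])
    have 1: "nice (\<lambda>Q. (- (real N - 1)) * (?W Q l * R Q))"
      by (intro nice_mult[OF nice_const] nWR l)
    have 2: "nice (\<lambda>Q. c y * (?W Q (split1 l x y) * ?W Q (split2 l x y) * R Q))" if "y \<in> C - {x}" for y
      by (intro nice_mult[OF nice_const] nWWR sp[OF that])
    have 3: "nice (\<lambda>Q. ?W Q (dminus l x p) * R Q - ?W Q (dplus l x p) * R Q)" if "p \<in> Pplus_e d e" for p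
      by (intro nice_diff nWR df[OF that])
    have 4: "nice (\<lambda>Q. \<Sum>y\<in>C - {x}. c y * (?W Q (split1 l x y) * ?W Q (split2 l x y) * R Q))"
      by (intro nice_sum 2)
    have 5: "nice (\<lambda>Q. \<Sum>p\<in>Pplus_e d e. ?W Q (dminus l x p) * R Q - ?W Q (dplus l x p) * R Q)"
      by (intro nice_sum 3)
    have a: "EV (\<lambda>Q. \<Sum>y\<in>C - {x}. c y * (?W Q (split1 l x y) * ?W Q (split2 l x y) * R Q))
      = (\<Sum>y\<in>C - {x}. c y * (real N ^ (?n + 2) * \<phi>N (split1 l x y # split2 l x y # ls)))"
      by (subst EV_sum, rule 2, assumption) (simp only: EV_cmult EVWW)
    have b: "EV (\<lambda>Q. \<Sum>p\<in>Pplus_e d e. ?W Q (dminus l x p) * R Q - ?W Q (dplus l x p) * R Q)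
      = (\<Sum>p\<in>Pplus_e d e. real N ^ (?n + 1) * \<phi>N (dminus l x p # ls) - real N ^ (?n + 1) * \<phi>N (dplus l x p # ls))"
    proof (subst EV_sum, rule 3, assumption, rule sum.cong[OF refl])
      fix p assume "p \<in> Pplus_e d e"
      then show "EV (\<lambda>Q. ?W Q (dminus l x p) * R Q - ?W Q (dplus l x p) * R Q)
        = real N ^ (?n + 1) * \<phi>N (dminus l x p # ls) - real N ^ (?n + 1) * \<phi>N (dplus l x p # ls)"
        by (subst EV_diff) (auto intro: nWR df simp only: EVW)
    qed
    show ?thesis
      unfolding A_def
      by (subst EV_add, intro nice_diff 1 4, intro nice_mult[OF nice_const] 5,
          subst EV_diff, rule 1, rule 4)
        (simp only: EV_cmult a b EVW)
  qed
  \<comment> \<open>All three groups carry this power: splittings have \<open>?n + 2\<close> traces,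
    while the factors \<open>N - 1\<close> and \<open>N * \<beta>\<close> supply the power missing
    from the terms with \<open>?n + 1\<close> traces. Against an error of order
    \<open>?n + 1\<close> this leaves 1/N.\<close>
  also have "\<dots> = - (real N ^ (?n + 2)) * Z"
  proof -
    have u1: "(\<Sum>y\<in>C - {x}. c y * (real N ^ (?n + 2) * \<phi>N (split1 l x y # split2 l x y # ls)))
      = real N ^ (?n + 2) * (\<Sum>y\<in>C - {x}. c y * \<phi>N (split1 l x y # split2 l x y # ls))"
      unfolding sum_distrib_left by (intro sum.cong refl mult.left_commute)
    have u2: "(\<Sum>p\<in>Pplus_e d e. real N ^ (?n + 1) * \<phi>N (dminus l x p # ls) - real N ^ (?n + 1) * \<phi>N (dplus l x p # ls))
      = real N ^ (?n + 1) * (\<Sum>p\<in>Pplus_e d e. \<phi>N (dminus l x p # ls) - \<phi>N (dplus l x p # ls))"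
      unfolding sum_distrib_left right_diff_distrib ..
    have u3: "real N ^ (?n + 2) = real N * real N ^ (?n + 1)" by simp
    have u4: "real N * (1 - 1 / real N) = real N - 1" using N by (simp add: right_diff_distrib)
    have "- (real N - 1) * (a * f) - real N * a * S + real N * \<beta> * (a * D)
       = - (real N * a) * ((1 - 1 / real N) * f + S - \<beta> * D)" for a f S D :: real
      unfolding u4[symmetric] by (simp add: algebra_simps)
    then show ?thesis unfolding Z_def u1 u2 unfolding u3 .
  qed
  finally have EVA: "EV A = - (real N ^ (?n + 2)) * Z" .
  have "real N ^ (?n + 1) * (real N * \<bar>Z\<bar>) = \<bar>EV A\<bar>"
    unfolding EVA by (simp add: abs_mult)
  also have "\<dots> \<le> real N ^ (?n + 1) * ?K" using bound by (simp only: mult.commute)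
  finally have "real N * \<bar>Z\<bar> \<le> ?K" using N by (subst (asm) mult_le_cancel_left_pos) simp_all
  then have "\<bar>Z\<bar> \<le> ?K / real N" using N by (subst pos_le_divide_eq) (simp_all only: mult.commute of_nat_0_less_iff)
  then show ?thesis unfolding Z_def c_def s_def .
qed

end

subsection \<open>The large \<open>N\<close> limit\<close>

lemma is_edge_vtx: "is_edge d f \<Longrightarrow> fst f \<in> vtx d \<and> snd f \<in> vtx d"
  by (auto simp: is_edge_def pos_edge_def)

text \<open>The base corner of a plaquette at \<open>e\<close> differs from \<open>fst e\<close> by
  at most 2 in each coordinate, a generous bound. Only the set of possible coordinate values is
  retained, which suffices because lists of fixed length over a finite set are finite in
  number.\<close>

lemma finite_Pplus_e: "finite (Pplus_e d e)"
proof -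
  define X where "X = {x. set x \<subseteq> (\<lambda>(c, t). c + t) ` (set (fst e) \<times> {-2..2::int}) \<and> length x = d}"
  have finX: "finite X"
    unfolding X_def by (intro finite_lists_length_eq finite_imageI finite_cartesian_product) auto
  have near: "set x \<subseteq> (\<lambda>(c, t). c + t) ` (set v \<times> {-2..2})"
    if "length x = length v" "\<And>k. k < length x \<Longrightarrow> \<bar>x ! k - v ! k\<bar> \<le> 2" for x v :: "int list"
  proof
    fix a assume "a \<in> set x"
    then obtain k where k: "k < length x" "a = x ! k" by (auto simp: in_set_conv_nth)
    then have "v ! k \<in> set v" "x ! k - v ! k \<in> {-2..2}" using that(1) that(2)[OF k(1)] by auto
    then show "a \<in> (\<lambda>(c, t). c + t) ` (set v \<times> {-2..2})"
      using k(2) by (intro image_eqI[of _ _ "(v ! k, x ! k - v ! k)"]) auto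
  qed
  have st: "\<bar>step y i ! k - y ! k\<bar> \<le> 1" if "i < length y" for y i k
    using that by (cases "k = i") (auto simp: step_def)
  have "Pplus_e d e \<subseteq> (\<lambda>(x, i, j). plaq x i j) ` (X \<times> {..<d} \<times> {..<d})"
  proof
    fix p assume p: "p \<in> Pplus_e d e"
    then obtain x i j where p': "p = plaq x i j" "x \<in> vtx d" "i < j" "j < d"
      by (auto simp: Pplus_e_def Pplus_def)
    have "fst e \<in> {x, step x i, step x j, step (step x i) j}"
      using p by (auto simp: Pplus_e_def p'(1) plaq_def einv_def prod_eq_iff)
    moreover have "\<bar>step (step x i) j ! k - x ! k\<bar> \<le> 2" for k
      using st[of i x k] st[of j "step x i" k] p' by (auto simp: vtx_def step_def)
    ultimately have "length x = length (fst e)" "\<bar>x ! k - fst e ! k\<bar> \<le> 2" for k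
      using st[of i x k] st[of j x k] p' by (auto simp: vtx_def abs_minus_commute step_def)
    then have "x \<in> X" using near[of x "fst e"] p'(2) by (auto simp: X_def vtx_def)
    then show "p \<in> (\<lambda>(x, i, j). plaq x i j) ` (X \<times> {..<d} \<times> {..<d})"
      using p' by (intro image_eqI[of _ _ "(x, i, j)"]) auto
  qed
  then show ?thesis by (rule finite_subset) (intro finite_imageI finite_cartesian_product finX finite_lessThan)
qed

lemma eventually_subset_exhaustion:
  assumes "incseq \<Lambda>" "finite V" "V \<subseteq> (\<Union>N. \<Lambda> N)" "strict_mono r"
  shows "eventually (\<lambda>k. V \<subseteq> \<Lambda> (r k)) sequentially"
proof -
  obtain n where n: "V \<subseteq> \<Lambda> n"
  proof -
    have "\<exists>n. V \<subseteq> \<Lambda> n" using assms(2,3)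
    proof (induction V rule: finite_induct)
      case (insert v V)
      then obtain a b where "V \<subseteq> \<Lambda> a" "v \<in> \<Lambda> b" by auto
      then show ?case
        using incseqD[OF assms(1), of a "max a b"] incseqD[OF assms(1), of b "max a b"]
        by (intro exI[of _ "max a b"]) auto
    qed simp
    then show thesis using that by blast
  qed
  have "V \<subseteq> \<Lambda> (r k)" if "k \<ge> n" for k
    using n incseqD[OF assms(1), of n "r k"] that seq_suble[OF assms(4), of k] by (meson order_trans)
  then show ?thesis by (auto simp: eventually_sequentially)
qed

lemma loop_edges: "is_loop d l \<Longrightarrow> f \<in> set l \<Longrightarrow> is_edge d f"
  by (simp add: is_loop_def closed_path_def)

lemma sg_einv: "is_edge d e \<Longrightarrow> sg (einv e) f = - sg e f"
  using einv_neq[of d e] by (auto simp: sg_def)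

lemma Pplus_e_einv: "Pplus_e d (einv e) = Pplus_e d e"
  by (auto simp: Pplus_e_def)

text \<open>The left side minus the right side is the limit of the finite expressions
  \<open>a\<close>, which are eventually bounded by a constant over \<open>N\<close>. Positivity of
  \<open>e\<close> is what lets its matrix be rotated directly as a coordinate of the
  configuration.\<close>

lemma loop_equation_limit_pos:
  fixes \<phi> :: "edge list list \<Rightarrow> real"
  assumes haar: "\<And>N. haar_SO N (\<sigma> N)"
    and fin: "\<And>N. finite (\<Lambda> N)" and inc: "incseq \<Lambda>" and un: "(\<Union>N. \<Lambda> N) = vtx d"
    and r: "strict_mono r"
    and lim: "\<And>s. loop_seq d s \<Longrightarrow>
           (\<lambda>k. phi_fin d (\<Lambda> (r k)) (r k) \<beta> (\<sigma> (r k)) s) \<longlonglongrightarrow> \<phi> s"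
    and l: "is_loop d l" and ls: "\<forall>v\<in>set ls. is_loop d v"
    and e: "pos_edge d e" and x: "x < length l" "l ! x = e \<or> l ! x = einv e"
  defines "C \<equiv> {y. y < length l \<and> (l ! y = e \<or> l ! y = einv e)}"
  shows "\<phi> (l # ls) + (\<Sum>y\<in>C - {x}. sg e (l ! x) * sg e (l ! y) * \<phi> (split1 l x y # split2 l x y # ls))
      = \<beta> * (\<Sum>p\<in>Pplus_e d e. \<phi> (dminus l x p # ls) - \<phi> (dplus l x p # ls))"
proof -
  define \<psi> where "\<psi> k = phi_fin d (\<Lambda> (r k)) (r k) \<beta> (\<sigma> (r k))" for k
  define K where "K = real (length l) + 2 * (\<Sum>i<length ls. real (length (ls ! i)))"
  define a where "a k = (1 - 1 / real (r k)) * \<psi> k (l # ls)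
    + (\<Sum>y\<in>C - {x}. sg e (l ! x) * sg e (l ! y) * \<psi> k (split1 l x y # split2 l x y # ls))
    - \<beta> * (\<Sum>p\<in>Pplus_e d e. \<psi> k (dminus l x p # ls) - \<psi> k (dplus l x p # ls))" for k
  have ie: "is_edge d e" using e by (simp add: is_edge_def)
  have lims: "(\<lambda>k. \<psi> k s) \<longlonglongrightarrow> \<phi> s" if "loop_seq d s" for s
    unfolding \<psi>_def by (rule lim[OF that])
  have r_top: "filterlim (\<lambda>k. real (r k)) at_top sequentially"
    by (rule filterlim_compose[OF filterlim_real_sequentially filterlim_subseq[OF r]])
  have inv0: "(\<lambda>k. c / real (r k)) \<longlonglongrightarrow> 0" for c
    by (rule real_tendsto_divide_at_top[OF tendsto_const r_top])
  have sl: "loop_seq d (split1 l x y # split2 l x y # ls)" if y: "y \<in> C - {x}" for y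
  proof -
    have "l ! y = l ! x \<or> l ! y = einv (l ! x)" using y x(2) by (auto simp: C_def)
    then show ?thesis
      using split_loops[OF l x(1), of y] y ls by (auto simp: loop_seq_def C_def)
  qed
  have dl: "loop_seq d (dminus l x p # ls)" "loop_seq d (dplus l x p # ls)" if p: "p \<in> Pplus_e d e" for p
  proof -
    have "p \<in> Pplus d" "l ! x \<in> set p \<or> einv (l ! x) \<in> set p" using p x(2) by (auto simp: Pplus_e_def)
    then show "loop_seq d (dminus l x p # ls)" "loop_seq d (dplus l x p # ls)"
      using deform_loops[OF l x(1), of p] ls by (auto simp: loop_seq_def)
  qed
  have a1: "a \<longlonglongrightarrow> (1 - 0) * \<phi> (l # ls)
    + (\<Sum>y\<in>C - {x}. sg e (l ! x) * sg e (l ! y) * \<phi> (split1 l x y # split2 l x y # ls))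
    - \<beta> * (\<Sum>p\<in>Pplus_e d e. \<phi> (dminus l x p # ls) - \<phi> (dplus l x p # ls))"
    unfolding a_def
    by (intro tendsto_intros inv0 lims sl dl) (use l ls in \<open>auto simp: loop_seq_def\<close>)
  have a2: "a \<longlonglongrightarrow> 0"
  proof (rule Lim_null_comparison[OF _ inv0[of K]])
    \<comment> \<open>Every edge the finite equation must find in the region: those of the loops and
      of all plaquettes at \<open>e\<close>. The set is finite, so the regions eventually contain
      all its endpoints.\<close>
    define F where "F = set l \<union> (\<Union>v\<in>set ls. set v) \<union> (\<Union>p\<in>Pplus_e d e. set p) \<union> {e}"
    define V where "V = fst ` F \<union> snd ` F"
    have F_edge: "is_edge d f" if fF: "f \<in> F" for f
    proof -
      consider "f \<in> set l" | v where "v \<in> set ls" "f \<in> set v" | p where "p \<in> Pplus d" "f \<in> set p" | "f = e"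
        using fF by (auto simp: F_def Pplus_e_def)
      then show ?thesis
      proof cases
        case 3
        then show ?thesis using plaq_walk walk_is_edge by metis
      qed (use l ls ie in \<open>auto intro: loop_edges\<close>)
    qed
    then have "V \<subseteq> vtx d" unfolding V_def using is_edge_vtx[OF F_edge] by blast
    moreover have "finite V" by (auto simp: V_def F_def finite_Pplus_e)
    ultimately have "eventually (\<lambda>k. V \<subseteq> \<Lambda> (r k)) sequentially"
      by (intro eventually_subset_exhaustion[OF inc _ _ r]) (simp_all add: un)
    \<comment> \<open>The subsequence may begin with the index 0, where dividing by \<open>N\<close>
      would be meaningless.\<close>
    moreover have "eventually (\<lambda>k. 0 < real (r k)) sequentially"
      using r_top unfolding filterlim_at_top_dense by blast
    ultimately show "eventually (\<lambda>k. norm (a k) \<le> K / real (r k)) sequentially"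
    proof eventually_elim
      case (elim k)
      interpret lattice_gauge d "r k" "\<Lambda> (r k)" \<beta> "\<sigma> (r k)"
        by standard (rule fin, rule haar)
      have inE: "f \<in> E \<or> einv f \<in> E" if "f \<in> F" "is_edge d f" for f
        using that elim(1) by (auto simp: Epos_L_def V_def is_edge_def)
      have sup: "supported v" if "set v \<subseteq> F" for v
        using that inE F_edge by (auto simp: supported_def)
      have "e \<in> E" using e elim(1) by (auto simp: Epos_L_def V_def F_def)
      moreover have "supported l" by (rule sup) (auto simp: F_def)
      moreover have "supported (ls ! i)" if "i < length ls" for i
        using that by (intro sup) (auto simp: F_def)
      moreover have "Pplus_e d e \<subseteq> Pplus_L d (\<Lambda> (r k))"
        using elim(1) by (auto simp: Pplus_L_def Pplus_e_def V_def F_def)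
      ultimately show ?case
        using loop_equation_finite[of e l ls x] elim(2) x
        by (simp add: a_def \<psi>_def K_def C_def)
    qed
  qed
  from LIMSEQ_unique[OF a1 a2] show ?thesis by simp
qed

text \<open>Reversing \<open>e\<close> changes both signs in the product
  \<open>sg e (l ! x) * sg e (l ! y)\<close> and preserves the occurrences and the plaquettes, so
  the equation is insensitive to orientation.\<close>

lemma loop_equation_limit:
  fixes \<phi> :: "edge list list \<Rightarrow> real"
  assumes haar: "\<And>N. haar_SO N (\<sigma> N)"
    and fin: "\<And>N. finite (\<Lambda> N)" and inc: "incseq \<Lambda>" and un: "(\<Union>N. \<Lambda> N) = vtx d"
    and r: "strict_mono r"
    and lim: "\<And>s. loop_seq d s \<Longrightarrow>
           (\<lambda>k. phi_fin d (\<Lambda> (r k)) (r k) \<beta> (\<sigma> (r k)) s) \<longlonglongrightarrow> \<phi> s"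
    and l: "is_loop d l" and ls: "\<forall>v\<in>set ls. is_loop d v"
    and e: "is_edge d e" and x: "x < length l" "l ! x = e \<or> l ! x = einv e"
  defines "C \<equiv> {y. y < length l \<and> (l ! y = e \<or> l ! y = einv e)}"
  shows "\<phi> (l # ls) + (\<Sum>y\<in>C - {x}. sg e (l ! x) * sg e (l ! y) * \<phi> (split1 l x y # split2 l x y # ls))
      = \<beta> * (\<Sum>p\<in>Pplus_e d e. \<phi> (dminus l x p # ls) - \<phi> (dplus l x p # ls))"
proof (cases "pos_edge d e")
  case True
  then show ?thesis
    unfolding C_def by (intro loop_equation_limit_pos[OF haar fin inc un r lim l ls _ x])
next
  case False
  then have "pos_edge d (einv e)" using e by (simp add: is_edge_def)
  moreover have "l ! x = einv e \<or> l ! x = einv (einv e)" using x(2) by auto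
  ultimately have "\<phi> (l # ls) + (\<Sum>y\<in>{y. y < length l \<and> (l ! y = einv e \<or> l ! y = einv (einv e))} - {x}.
      sg (einv e) (l ! x) * sg (einv e) (l ! y) * \<phi> (split1 l x y # split2 l x y # ls))
      = \<beta> * (\<Sum>p\<in>Pplus_e d (einv e). \<phi> (dminus l x p # ls) - \<phi> (dplus l x p # ls))"
    by (intro loop_equation_limit_pos[OF haar fin inc un r lim l ls _ x(1)])
  then show ?thesis
    by (simp add: C_def sg_einv[OF e] Pplus_e_einv disj_commute)
qed

theorem theorem9p1:
  fixes d :: nat and \<beta> :: real
    and \<Lambda> :: "nat \<Rightarrow> vertex set"
    and \<sigma> :: "nat \<Rightarrow> mat measure"
    and r :: "nat \<Rightarrow> nat"
    and \<phi> :: "edge list list \<Rightarrow> real"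
    and l1 :: "edge list" and ls :: "edge list list"
  assumes "d \<ge> 2"
    and "\<And>N. haar_SO N (\<sigma> N)"
    and "\<And>N. finite (\<Lambda> N) \<and> \<Lambda> N \<subseteq> vtx d"
    and "\<And>N. \<Lambda> N \<subseteq> \<Lambda> (Suc N)"
    and "(\<Union>N. \<Lambda> N) = vtx d"
    and "strict_mono r"
    and "\<And>s. loop_seq d s \<Longrightarrow>
           (\<lambda>k. phi_fin d (\<Lambda> (r k)) (r k) \<beta> (\<sigma> (r k)) s) \<longlonglongrightarrow> \<phi> s"
    and "is_loop d l1" and "\<forall>l\<in>set ls. is_loop d l"
  shows
    "(let e = hd l1;
          A1 = {x. x < length l1 \<and> l1 ! x = e};
          B1 = {x. x < length l1 \<and> l1 ! x = einv e};
          C1 = A1 \<union> B1;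
          m = card C1;
          T = (\<lambda>x y. \<phi> (split1 l1 x y # split2 l1 x y # ls))
      in real m * \<phi> (l1 # ls) =
           ((\<Sum>x\<in>A1. \<Sum>y\<in>B1. T x y) + (\<Sum>x\<in>B1. \<Sum>y\<in>A1. T x y)
            - (\<Sum>x\<in>A1. \<Sum>y\<in>A1 - {x}. T x y) - (\<Sum>x\<in>B1. \<Sum>y\<in>B1 - {x}. T x y))
         + (\<beta> * (\<Sum>p\<in>Pplus_e d e. \<Sum>x\<in>C1. \<phi> (dminus l1 x p # ls))
            - \<beta> * (\<Sum>p\<in>Pplus_e d e. \<Sum>x\<in>C1. \<phi> (dplus l1 x p # ls))))"
proof -
  define e where "e = hd l1"
  define A where "A = {x. x < length l1 \<and> l1 ! x = e}"
  define B where "B = {x. x < length l1 \<and> l1 ! x = einv e}"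
  define T where "T x y = \<phi> (split1 l1 x y # split2 l1 x y # ls)" for x y
  define D where "D x = (\<Sum>p\<in>Pplus_e d e. \<phi> (dminus l1 x p # ls) - \<phi> (dplus l1 x p # ls))" for x
  define s where "s x = sg e (l1 ! x)" for x
  have "l1 \<noteq> []" using assms(8) by (simp add: is_loop_def closed_path_def)
  then have e: "is_edge d e" using loop_edges[OF assms(8)] by (simp add: e_def)
  have inc: "incseq \<Lambda>" using assms(4) by (rule incseq_SucI)
  have fin: "finite A" "finite B" by (simp_all add: A_def B_def)
  have disj: "A \<inter> B = {}" using einv_neq[OF e] by (auto simp: A_def B_def)
  have sA: "x \<in> A \<Longrightarrow> s x = 1" and sB: "x \<in> B \<Longrightarrow> s x = -1" for x
    using e by (simp_all add: s_def A_def B_def)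
  have C: "A \<union> B = {y. y < length l1 \<and> (l1 ! y = e \<or> l1 ! y = einv e)}" by (auto simp: A_def B_def)
  \<comment> \<open>One equation per location; adding all of them turns the left side into
    \<open>m\<close> copies of the same value.\<close>
  have eq: "\<phi> (l1 # ls) = - (\<Sum>y\<in>A \<union> B - {x}. s x * s y * T x y) + \<beta> * D x" if "x \<in> A \<union> B" for x
  proof -
    have "\<phi> (l1 # ls) + (\<Sum>y\<in>A \<union> B - {x}. s x * s y * T x y) = \<beta> * D x"
      unfolding C s_def T_def D_def
      by (rule loop_equation_limit[OF assms(2) conjunct1[OF assms(3)] inc assms(5,6,7,8,9) e])
        (use that in \<open>auto simp: A_def B_def\<close>)
    then show ?thesis by linarith
  qed
  \<comment> \<open>Equal orientations have sign product 1 and enter the equation negatively,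
    opposite ones positively. Removing \<open>x\<close> affects only its own class, since the two
    classes are disjoint.\<close>
  have S1: "(\<Sum>y\<in>A \<union> B - {x}. s x * s y * T x y) = (\<Sum>y\<in>A - {x}. T x y) - (\<Sum>y\<in>B. T x y)" if "x \<in> A" for x
  proof -
    have "A \<union> B - {x} = (A - {x}) \<union> B" "(A - {x}) \<inter> B = {}" using that disj by auto
    then have "(\<Sum>y\<in>A \<union> B - {x}. s x * s y * T x y)
       = (\<Sum>y\<in>A - {x}. s x * s y * T x y) + (\<Sum>y\<in>B. s x * s y * T x y)"
      using fin by (simp add: sum.union_disjoint)
    also have "\<dots> = (\<Sum>y\<in>A - {x}. T x y) + (\<Sum>y\<in>B. - T x y)"
      using that by (intro arg_cong2[of _ _ _ _ "(+)"] sum.cong refl) (auto simp: sA sB)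
    finally show ?thesis by (simp add: sum_negf)
  qed
  have S2: "(\<Sum>y\<in>A \<union> B - {x}. s x * s y * T x y) = (\<Sum>y\<in>B - {x}. T x y) - (\<Sum>y\<in>A. T x y)" if "x \<in> B" for x
  proof -
    have "A \<union> B - {x} = (B - {x}) \<union> A" "(B - {x}) \<inter> A = {}" using that disj by auto
    then have "(\<Sum>y\<in>A \<union> B - {x}. s x * s y * T x y)
       = (\<Sum>y\<in>B - {x}. s x * s y * T x y) + (\<Sum>y\<in>A. s x * s y * T x y)"
      using fin by (simp add: sum.union_disjoint)
    also have "\<dots> = (\<Sum>y\<in>B - {x}. T x y) + (\<Sum>y\<in>A. - T x y)"
      using that by (intro arg_cong2[of _ _ _ _ "(+)"] sum.cong refl) (auto simp: sA sB)
    finally show ?thesis by (simp add: sum_negf)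
  qed
  have "real (card (A \<union> B)) * \<phi> (l1 # ls) = (\<Sum>x\<in>A \<union> B. \<phi> (l1 # ls))" by simp
  also have "\<dots> = (\<Sum>x\<in>A \<union> B. - (\<Sum>y\<in>A \<union> B - {x}. s x * s y * T x y) + \<beta> * D x)"
    by (intro sum.cong refl eq)
  also have "\<dots> = - (\<Sum>x\<in>A \<union> B. \<Sum>y\<in>A \<union> B - {x}. s x * s y * T x y) + \<beta> * (\<Sum>x\<in>A \<union> B. D x)"
    by (simp only: sum.distrib sum_negf sum_distrib_left)
  also have "(\<Sum>x\<in>A \<union> B. \<Sum>y\<in>A \<union> B - {x}. s x * s y * T x y)
     = (\<Sum>x\<in>A. (\<Sum>y\<in>A - {x}. T x y) - (\<Sum>y\<in>B. T x y)) + (\<Sum>x\<in>B. (\<Sum>y\<in>B - {x}. T x y) - (\<Sum>y\<in>A. T x y))"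
    unfolding sum.union_disjoint[OF fin disj] by (intro arg_cong2[of _ _ _ _ "(+)"] sum.cong refl S1 S2)
  also have "(\<Sum>x\<in>A \<union> B. D x) = (\<Sum>p\<in>Pplus_e d e. \<Sum>x\<in>A \<union> B. \<phi> (dminus l1 x p # ls))
      - (\<Sum>p\<in>Pplus_e d e. \<Sum>x\<in>A \<union> B. \<phi> (dplus l1 x p # ls))"
    unfolding D_def by (subst sum.swap) (simp only: sum_subtractf)
  finally show ?thesis
    unfolding Let_def e_def[symmetric] A_def[symmetric] B_def[symmetric] T_def[symmetric]
    by (simp only: sum_subtractf right_diff_distrib)
qed

end
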